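(* Let the field $D$, the levels $\gamma_-(\cdot),\gamma_\star(\cdot),\gamma_+(\cdot)$, the set $Z_{\rm reg}$, the desired vicinity $V_\star(t)$, the initial location $\boldsymbol r_{\rm in}$ and the speed bound $\bar v>0$ satisfy the assumptions (A1)–(A4) listed in the context. Let $\Delta_\nabla>0$ and $\Delta_\gamma>0$ be such that $$\rho\ge\Delta_\nabla\ \text{in } Z_{\rm reg},\qquad \gamma_-(t)+\Delta_\gamma\le\gamma_\star(t)\le\gamma_+(t)-\Delta_\gamma\ \ \forall t\ge0,\qquad D[0,\boldsymbol r_{\rm in}]\ge\gamma_-(0)+\Delta_\gamma/2 .$$ Let $d_\ast\in\mathbb{R}$ be arbitrary, and suppose that $\nu>0$ and $\mu>0$ satisfy the following conditions for some $\varepsilon>0$: (a) $\nu>\bar\gamma$ and $\bar v\ge|\lambda|+\rho^{-1}\nu+\varepsilon$ everywhere in $Z_{\rm reg}$; (b) everywhere in $Z_{\rm reg}$ and for both choices of the sign in $v_T:=\pm\sqrt{\bar v^2-[\lambda+\rho^{-1}\bar\gamma]^2}$, $$\mu\ge\frac1{\nu-\bar\gamma}\left[-2\omega-\varkappa v_T+2\frac{\tau_\rho\bar\gamma}{\rho}+2\frac{v_\rho\bar\gamma}{v_T\rho}-\frac{\alpha}{v_T}+\frac{n_\rho\bar\gamma^2}{v_T\rho^2}\right]+\varepsilon ;$$ (c) everywhere in $Z_{\rm reg}$, $\displaystyle \mu\ge\frac{\omega+\tau_\rho(\lambda-\bar v)}{\rho(\bar v-\lambda)-\nu}+\varepsilon$;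 (d) $\displaystyle \mu>\frac1{\nu-\bar\gamma}\min_{k=1,2,\dots}\max\{a_1(k),a_2(k)\}$, where $$a_1(k):=2b_\omega^\nabla\Big[1+\frac1k\Big]+2\bar v\sqrt{b_\varkappa^2+b_\tau^2}\Big[2+\frac1k\Big],\qquad a_2(k):=2b_\rho\,\frac{(2k+1)\bar v+2\pi(k+1)\big(b_\lambda+\Delta_\nabla^{-1}\bar\gamma\big)}{\Delta_\gamma}.$$ Then the closed-loop trajectory starting at $\boldsymbol r(0)=\boldsymbol r_{\rm in}$ reaches $V_\star(t)$ in a finite time $t_0$ and stays there afterwards: $\boldsymbol r(t)\in V_\star(t)$ for all $t\ge t_0$.
   Context: **Closed-loop system.** A point robot $\boldsymbol r(t)\in\mathbb{R}^2$ in a time-varying scalar field $D(t,\boldsymbol r)$, $t\ge0$, moves according to $\dot{\boldsymbol r}=\bar v\,\vec e\{\mu[d(t)-\nu t-d_\ast]\}$, $\boldsymbol r(0)=\boldsymbol r_{\rm in}$, where $d(t):=D[t,\boldsymbol r(t)]$, $\vec e(\theta):=(\cos\theta,\sin\theta)^\top$. **Field characteristics.** $\nabla$ and $D''$ denote the spatial gradient and the spatial Hessian, subscripts $t$ denote time derivatives, $\langle\cdot;\cdot\rangle$ is the inner product. At points where $\nabla D\ne0$, $N:=\nabla D/\|\nabla D\|$, and $T$ is the unit vector obtained by rotating $N$ clockwise by $\pi/2$ (so $(T,N)$ is right-handed). The characteristics of the spatial isolines are given by: $\rho=\|\nabla D\|$ (density of isolines), $\lambda=-D'_t/\|\nabla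 D\|$ (front velocity), $v_\rho=\langle\nabla D'_t+\lambda D''N;N\rangle/\|\nabla D\|$ (relative growth rate of $\rho$ over time), $\omega=-\langle\nabla D'_t+\lambda D''N;T\rangle/\|\nabla D\|$ (angular velocity of the isoline), $\alpha=-\frac{D''_{tt}+\lambda\langle\nabla D'_t;N\rangle}{\|\nabla D\|}-\lambda v_\rho$ (front acceleration), $\varkappa=-\langle D''T;T\rangle/\|\nabla D\|$ (signed curvature), $\omega_\nabla=-\langle\nabla D'_t;T\rangle/\|\nabla D\|$ (angular velocity of the gradient), $\tau_\rho=\langle D''N;T\rangle/\|\nabla D\|$, $n_\rho=\langle D''N;N\rangle/\|\nabla D\|$ (relative growth rates of $\rho$ under tangential and normal displacement). **Assumptions.** (A1) $D$ is $C^2$-smooth, and there exist continuous functions $\boldsymbol r^0(t)\in\mathbb{R}^2$ and $\gamma_{\inf}(t)<D[t,\boldsymbol r^0(t)]$ such that $\nabla D(t,\boldsymbol r)\ne0$ for all $\boldsymbol r\ne\boldsymbol r^0(t)$ and $D(t,\boldsymbol r)\to\gamma_{\inf}(t)$ as $\|\boldsymbol r\|\to\infty$. (Hence $\boldsymbol r^0(t)$ is the maximizer of $D(t,\cdot)$.) (A2) $V_\star(t)$ is the desired $R_\star$-neighborhood of $\boldsymbol r^0(t)$ ($R_\star>0$ given). The functions $\gamma_-,\gamma_\star,\gamma_+$ of $t\ge0$ are smooth, $\gamma_{\inf}(t)<\gamma_-(t)<\gamma_\star(t)<\gamma_+(t)<D[t,\boldsymbol r^0(t)]$ for all $t$, $\gamma_-(0)<D[0,\boldsymbol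 r_{\rm in}]$, and $D(t,\boldsymbol r)\ge\gamma_\star(t)\Rightarrow\boldsymbol r\in V_\star(t)$. Put $Z_{\rm reg}:=\{(t,\boldsymbol r):t\ge0,\ \gamma_-(t)\le D(t,\boldsymbol r)\le\gamma_+(t)\}$. (A3) There exist constants $b_\rho,b_\lambda,b_\omega,b_\omega^\nabla,b_\varkappa,b_v,b_\alpha,b_\tau,b_n$ and $\gamma_+^0,\bar\gamma$ (fixed in the sequel) such that $|\rho|\le b_\rho$, $|\lambda|\le b_\lambda$, $|\omega|\le b_\omega$, $|\omega_\nabla|\le b_\omega^\nabla$, $|\varkappa|\le b_\varkappa$, $|v_\rho|\le b_v$, $|\alpha|\le b_\alpha$, $|\tau_\rho|\le b_\tau$, $|n_\rho|\le b_n$ everywhere in $Z_{\rm reg}$, and $\gamma_+(t)\le\gamma_+^0$, $|\dot\gamma_i(t)|\le\bar\gamma$ for all $t\ge 0$ and $i=-,+,\star$. (A4) There exists $\varepsilon>0$ such that $\rho\ge\varepsilon$ and $\bar v\ge|\lambda|+\rho^{-1}\bar\gamma+\varepsilon$ everywhere in $Z_{\rm reg}$, and $\gamma_-(t)+\varepsilon\le\gamma_\star(t)\le\gamma_+(t)-\varepsilon$ for all $t\ge0$. *)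

theory Defs
  imports "HOL-Analysis.Analysis"
begin

definition C1_on :: "'a::real_normed_vector set \<Rightarrow> ('a \<Rightarrow> 'b::real_normed_vector) \<Rightarrow> bool" where
  "C1_on S f \<longleftrightarrow> (\<exists>f'. (\<forall>x\<in>S. (f has_derivative blinfun_apply (f' x)) (at x within S)) \<and>
                    continuous_on S f')"

definition C2_on :: "'a::real_normed_vector set \<Rightarrow> ('a \<Rightarrow> 'b::real_normed_vector) \<Rightarrow> bool" where
  "C2_on S f \<longleftrightarrow> (\<exists>f'. (\<forall>x\<in>S. (f has_derivative blinfun_apply (f' x)) (at x within S)) \<and>
                    C1_on S f')"

(* Derivatives in time are taken within the time domain [0, oo), hence are one-sided at 0. *)
definition time_deriv :: "(real \<Rightarrow> 'a::real_normed_vector) \<Rightarrow> real \<Rightarrow> 'a" where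
  "time_deriv g t = vector_derivative g (at t within {0..})"

definition gradient :: "('a::real_inner \<Rightarrow> real) \<Rightarrow> 'a \<Rightarrow> 'a" where
  "gradient f x = (THE g. GDERIV f x :> g)"

definition hessian :: "(real^'n \<Rightarrow> real) \<Rightarrow> real^'n \<Rightarrow> real^'n^'n" where
  "hessian f x = jacobian (gradient f) (at x)"

type_synonym field2 = "real \<Rightarrow> real^2 \<Rightarrow> real"

definition Dt :: "field2 \<Rightarrow> field2" where
  "Dt D t p = time_deriv (\<lambda>s. D s p) t"

definition Dtt :: "field2 \<Rightarrow> field2" where
  "Dtt D t p = time_deriv (\<lambda>s. Dt D s p) t"

definition grad_Dt :: "field2 \<Rightarrow> real \<Rightarrow> real^2 \<Rightarrow> real^2" where
  "grad_Dt D t p = gradient (Dt D t) p"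

definition rotate_cw :: "real^2 \<Rightarrow> real^2" where
  "rotate_cw u = vector [u $ 2, - (u $ 1)]"

definition normalN :: "field2 \<Rightarrow> real \<Rightarrow> real^2 \<Rightarrow> real^2" where
  "normalN D t p = gradient (D t) p /\<^sub>R norm (gradient (D t) p)"

definition tangentT :: "field2 \<Rightarrow> real \<Rightarrow> real^2 \<Rightarrow> real^2" where
  "tangentT D t p = rotate_cw (normalN D t p)"

(* All the characteristics below are meaningful only where the spatial gradient is nonzero. *)

definition rho :: "field2 \<Rightarrow> field2" where
  "rho D t p = norm (gradient (D t) p)"

definition front_vel :: "field2 \<Rightarrow> field2" where
  "front_vel D t p = - Dt D t p / norm (gradient (D t) p)"

definition v_rho :: "field2 \<Rightarrow> field2" where
  "v_rho D t p =
     ((grad_Dt D t p + front_vel D t p *\<^sub>R (hessian (D t) p *v normalN D t p)) \<bullet> normalN D t p)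
       / norm (gradient (D t) p)"

definition omega :: "field2 \<Rightarrow> field2" where
  "omega D t p =
     - ((grad_Dt D t p + front_vel D t p *\<^sub>R (hessian (D t) p *v normalN D t p)) \<bullet> tangentT D t p)
       / norm (gradient (D t) p)"

definition front_acc :: "field2 \<Rightarrow> field2" where
  "front_acc D t p =
     - ((Dtt D t p + front_vel D t p * (grad_Dt D t p \<bullet> normalN D t p)) / norm (gradient (D t) p))
     - front_vel D t p * v_rho D t p"

definition kappa :: "field2 \<Rightarrow> field2" where
  "kappa D t p =
     - ((hessian (D t) p *v tangentT D t p) \<bullet> tangentT D t p) / norm (gradient (D t) p)"

definition omega_grad :: "field2 \<Rightarrow> field2" where
  "omega_grad D t p = - (grad_Dt D t p \<bullet> tangentT D t p) / norm (gradient (D t) p)"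

definition tau_rho :: "field2 \<Rightarrow> field2" where
  "tau_rho D t p =
     ((hessian (D t) p *v normalN D t p) \<bullet> tangentT D t p) / norm (gradient (D t) p)"

definition n_rho :: "field2 \<Rightarrow> field2" where
  "n_rho D t p =
     ((hessian (D t) p *v normalN D t p) \<bullet> normalN D t p) / norm (gradient (D t) p)"

definition Z_reg :: "field2 \<Rightarrow> (real \<Rightarrow> real) \<Rightarrow> (real \<Rightarrow> real) \<Rightarrow> (real \<times> (real^2)) set" where
  "Z_reg D \<gamma>m \<gamma>p = {(t, p). 0 \<le> t \<and> \<gamma>m t \<le> D t p \<and> D t p \<le> \<gamma>p t}"

definition evec :: "real \<Rightarrow> real^2" where
  "evec \<theta> = vector [cos \<theta>, sin \<theta>]"

definition closed_loop_trajectory ::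
  "field2 \<Rightarrow> real \<Rightarrow> real \<Rightarrow> real \<Rightarrow> real \<Rightarrow> real^2 \<Rightarrow> (real \<Rightarrow> real^2) \<Rightarrow> bool" where
  "closed_loop_trajectory D v \<mu> \<nu> dstar r_in r \<longleftrightarrow>
     r 0 = r_in \<and>
     (\<forall>t\<ge>0. (r has_vector_derivative v *\<^sub>R evec (\<mu> * (D t (r t) - \<nu> * t - dstar)))
               (at t within {0..}))"

definition a1 :: "real \<Rightarrow> real \<Rightarrow> real \<Rightarrow> real \<Rightarrow> nat \<Rightarrow> real" where
  "a1 v b\<omega>grad b\<kappa> b\<tau> k =
     2 * b\<omega>grad * (1 + 1 / real k) + 2 * v * sqrt (b\<kappa>^2 + b\<tau>^2) * (2 + 1 / real k)"

definition a2 :: "real \<Rightarrow> real \<Rightarrow> real \<Rightarrow> real \<Rightarrow> real \<Rightarrow> real \<Rightarrow> nat \<Rightarrow> real" where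
  "a2 v b\<rho> b_lam \<gamma>bar \<Delta>grad \<Delta>\<gamma> k =
     2 * b\<rho> * (((2 * real k + 1) * v + 2 * pi * (real k + 1) * (b_lam + inverse \<Delta>grad * \<gamma>bar)) / \<Delta>\<gamma>)"

(* Since a2 tends to infinity with k whenever b\<rho>, v, \<Delta>\<gamma> > 0 and b_lam, \<gamma>bar, \<Delta>grad are
   nonnegative, this infimum over k = 1, 2, ... is attained, i.e. it is a minimum. *)
definition min_a ::
  "real \<Rightarrow> real \<Rightarrow> real \<Rightarrow> real \<Rightarrow> real \<Rightarrow> real \<Rightarrow> real \<Rightarrow> real \<Rightarrow> real \<Rightarrow> real" where
  "min_a v b\<rho> b_lam b\<omega>grad b\<kappa> b\<tau> \<gamma>bar \<Delta>grad \<Delta>\<gamma> =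
     (INF k\<in>{1..}. max (a1 v b\<omega>grad b\<kappa> b\<tau> k) (a2 v b\<rho> b_lam \<gamma>bar \<Delta>grad \<Delta>\<gamma> k))"

end

(* Let phi be the angle from the field gradient to the velocity, d the field value at the robot, and
   gbar a bound for the rates of the levels. The state "d' >= gbar, tangential velocity negative" cannot be
   left inside the working zone: condition (b) gives d'' > 0 on the edge d' = gbar, and condition (c) makes
   the velocity turn the right way where it is normal to the isoline. Outside this state, d' <= gbar can
   last for at most one turn of phi, since there phi grows at a rate >= Omega > 0 and phi = 0 (mod 2 pi)
   means d' > gbar. By condition (d) such a turn costs less than half the gap between the levels, so a robot
   starting half a gap above the lowest level stays in the zone, is captured, climbs to the upper level,
   and afterwards never loses the gap down to the desired level. Since d' can approach gbar, linear growth
   of d relative to the upper level needs (b) in a strip gbar <= d' <= gbar + delta; this is where the bounds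
   (A3) enter, through uniform continuity on a compact box. All differentiation takes place at t > 0. *)
theory Submission
  imports Defs
begin

text \<open>Losses are measured against the angle, not against time: while d' <= gbar the angle
  turns at rate at least \<open>\<Omega>\<close>, so the loss rate divided by
  \<open>\<Omega>\<close> and integrated over one turn bounds the whole loss. In that integral the
  normal velocity contributes the negative part of the cosine, whose exact integral over a period is
  2. To avoid splitting at its kinks, a smooth majorant replaces it. The price is the constant 9/4,
  which is exactly what condition (d) tolerates at k = 1; larger k leave slack. Condition (d) enters
  through any k for which \<open>a1\<close> and \<open>a2\<close> are both below \<mu> (\<nu> -
  gbar): \<open>a1\<close> keeps \<open>\<Omega>\<close> above a fixed fraction of this number, and
  \<open>a2\<close> then bounds the loss. Geometry and dynamics are kept apart. The locale knows
  only scalar functions of time and uniform margins; the plane, the moving frame and the Hessian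
  appear only where its assumptions are verified. Differentiation is confined to t > 0 because at t
  = 0 the field is given on one side only; the strict inequality between loss and half gap allows
  the start to be moved to a small positive time.\<close>

section \<open>Continuity arguments on the real line\<close>

text \<open>Needed for predicates that define neither an open nor a closed set, such as
  \<open>captured\<close>, which combines a weak and a strict inequality. At the infimum of the
  violations, \<open>left\<close> yields the predicate and \<open>right\<close> carries it further,
  a contradiction.\<close>

lemma real_interval_induct:
  fixes a b :: real
  assumes "a \<le> b" and start: "P a"
    and right: "\<And>u. a \<le> u \<Longrightarrow> u < b \<Longrightarrow> P u \<Longrightarrow> \<exists>e>0. \<forall>x. u < x \<and> x < u + e \<longrightarrow> P x"
    and left: "\<And>u. a < u \<Longrightarrow> u \<le> b \<Longrightarrow> (\<And>x. a \<le> x \<Longrightarrow> x < u \<Longrightarrow> P x) \<Longrightarrow> P u"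
    and x: "a \<le> x" "x \<le> b"
  shows "P x"
proof (rule ccontr)
  assume nP: "\<not> P x"
  define B where "B = {y. a \<le> y \<and> y \<le> b \<and> \<not> P y}"
  have xB: "x \<in> B" and bdd: "bdd_below B"
    using nP x by (auto simp: B_def bdd_below_def)
  define u where "u = Inf B"
  have "u \<le> x" unfolding u_def by (rule cInf_lower[OF xB bdd])
  moreover have "a \<le> u" unfolding u_def using xB by (intro cInf_greatest) (auto simp: B_def)
  ultimately have u: "a \<le> u" "u \<le> x" by auto
  have below: "P y" if "a \<le> y" "y < u" for y
    using cInf_lower[OF _ bdd, of y] that u x unfolding u_def B_def by force
  have Pu: "P u"
    using start left[of u] below u x by (cases "u = a") auto
  then have "u < x" using nP u by (cases "u = x") auto
  then obtain e where e: "e > 0" "\<And>y. u < y \<Longrightarrow> y < u + e \<Longrightarrow> P y"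
    using right[of u] Pu u x by auto
  have "u + e \<le> Inf B"
  proof (rule cInf_greatest)
    show "B \<noteq> {}" using xB by auto
    fix y assume y: "y \<in> B"
    then have "u \<le> y" unfolding u_def by (rule cInf_lower[OF _ bdd])
    moreover have "y \<noteq> u" using y Pu by (auto simp: B_def)
    ultimately show "u + e \<le> y" using e(2)[of y] y by (force simp: B_def)
  qed
  then show False using e(1) by (simp add: u_def)
qed

lemma le_left_limit:
  fixes f :: "real \<Rightarrow> real"
  assumes "isCont f u" "a < u" "\<And>x. a \<le> x \<Longrightarrow> x < u \<Longrightarrow> m \<le> f x"
  shows "m \<le> f u"
proof (rule tendsto_lowerbound)
  show "(f \<longlongrightarrow> f u) (at_left u)"
    using assms(1) by (simp add: continuous_at_imp_continuous_at_within continuous_within[symmetric])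
  show "\<forall>\<^sub>F x in at_left u. m \<le> f x"
    using assms(2,3) by (auto simp: eventually_at_left intro!: exI[of _ a])
qed simp

lemma isCont_less_nbhd:
  fixes f :: "real \<Rightarrow> real"
  assumes "isCont f u" "m < f u"
  shows "\<exists>e>0. \<forall>x. \<bar>x - u\<bar> < e \<longrightarrow> m < f x"
proof -
  have "\<forall>\<^sub>F x in nhds u. m < f x"
    using assms order_tendstoD(1)[of f "f u" "nhds u" m]
    by (simp add: isCont_def tendsto_at_iff_tendsto_nhds)
  then show ?thesis by (auto simp: eventually_nhds_metric dist_real_def)
qed

text \<open>On the level itself the positive derivative pushes \<open>f\<close> upward, strictly
  above it continuity leaves room; the limit from the left preserves the weak inequality.\<close>

lemma barrier:
  fixes f f' :: "real \<Rightarrow> real"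
  assumes der: "\<And>t. a \<le> t \<Longrightarrow> t \<le> b \<Longrightarrow> (f has_real_derivative f' t) (at t)"
    and pos: "\<And>t. a \<le> t \<Longrightarrow> t \<le> b \<Longrightarrow> f t = m \<Longrightarrow> f' t > 0"
    and "m \<le> f a" and x: "a \<le> x" "x \<le> b"
  shows "m \<le> f x"
proof (rule real_interval_induct[of a b "\<lambda>x. m \<le> f x"])
  fix u assume u: "a \<le> u" "u < b" and mu: "m \<le> f u"
  show "\<exists>e>0. \<forall>x. u < x \<and> x < u + e \<longrightarrow> m \<le> f x"
  proof (cases "f u = m")
    case True
    obtain e where "e > 0" "\<And>h. h > 0 \<Longrightarrow> h < e \<Longrightarrow> f u < f (u + h)"
      using DERIV_pos_inc_right[OF der[of u] pos[of u]] u True by auto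
    then show ?thesis using True
      by (intro exI[of _ e]) (smt (verit, ccfv_SIG) add_diff_cancel_left' diff_add_cancel)
  next
    case False
    then obtain e where "e > 0" "\<forall>x. \<bar>x - u\<bar> < e \<longrightarrow> m < f x"
      using isCont_less_nbhd[OF DERIV_isCont[OF der[of u]], of m] u mu by auto
    then show ?thesis by (intro exI[of _ e]) (auto intro!: less_imp_le)
  qed
next
  fix u assume "a < u" "u \<le> b" "\<And>x. a \<le> x \<Longrightarrow> x < u \<Longrightarrow> m \<le> f x"
  then show "m \<le> f u"
    using le_left_limit[OF DERIV_isCont[OF der[of u]], of a m] by auto
qed (use assms in auto)

lemma linear_growth:
  fixes f f' :: "real \<Rightarrow> real"
  assumes "\<And>t. a \<le> t \<Longrightarrow> t \<le> b \<Longrightarrow> (f has_real_derivative f' t) (at t)"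
    and "\<And>t. a \<le> t \<Longrightarrow> t \<le> b \<Longrightarrow> m \<le> f' t" and "a \<le> b"
  shows "f a + m * (b - a) \<le> f b"
proof -
  have "f a - m * a \<le> f b - m * b"
  proof (rule DERIV_nonneg_imp_nondecreasing[OF \<open>a \<le> b\<close>])
    fix x assume "a \<le> x" "x \<le> b"
    then show "\<exists>y. ((\<lambda>x. f x - m * x) has_real_derivative y) (at x) \<and> 0 \<le> y"
      using assms(1,2)[of x]
      by (intro exI[of _ "f' x - m"]) (auto intro!: derivative_eq_intros)
  qed
  then show ?thesis by (simp add: algebra_simps)
qed

section \<open>Lifting a rotating unit vector to an angle, and the negative part of the
  cosine\<close>

text \<open>The lift is the integral of the rate, started at an argument of the initial vector, so
  it is differentiable by construction and only its agreement with \<open>C\<close> and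
  \<open>S\<close> has to be shown.\<close>

lemma angle_lift:
  fixes C S \<xi> :: "real \<Rightarrow> real"
  assumes "a \<le> b"
    and unit: "\<And>t. a \<le> t \<Longrightarrow> t \<le> b \<Longrightarrow> (C t)\<^sup>2 + (S t)\<^sup>2 = 1"
    and dC: "\<And>t. a \<le> t \<Longrightarrow> t \<le> b \<Longrightarrow> (C has_real_derivative - (\<xi> t * S t)) (at t)"
    and dS: "\<And>t. a \<le> t \<Longrightarrow> t \<le> b \<Longrightarrow> (S has_real_derivative \<xi> t * C t) (at t)"
    and cont: "continuous_on {a..b} \<xi>"
  shows "\<exists>\<phi>. 0 \<le> \<phi> a \<and> \<phi> a < 2 * pi \<and>
    (\<forall>t\<in>{a..b}. (\<phi> has_real_derivative \<xi> t) (at t within {a..b}) \<and>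
      C t = cos (\<phi> t) \<and> S t = sin (\<phi> t))"
proof -
  obtain p where p: "0 \<le> p" "p < 2 * pi" "C a = cos p" "S a = sin p"
    using sincos_total_2pi[of "C a" "S a"] unit[of a] \<open>a \<le> b\<close> by auto
  define \<phi> where "\<phi> t = p + integral {a..t} \<xi>" for t
  have \<phi>a: "\<phi> a = p" by (simp add: \<phi>_def)
  have d\<phi>: "(\<phi> has_real_derivative \<xi> t) (at t within {a..b})" if "a \<le> t" "t \<le> b" for t
    using integral_has_real_derivative[OF cont, of t] that unfolding \<phi>_def
    by (auto intro!: derivative_eq_intros)
  \<comment> \<open>These are the cosine and sine of the difference between the true angle and
    \<phi>. Both have zero derivative, hence keep their initial values 1 and 0.\<close>
  have const: "C t * cos (\<phi> t) + S t * sin (\<phi> t) = 1 \<and> S t * cos (\<phi> t) - C t * sin (\<phi> t) = 0"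
    if t: "a \<le> t" "t \<le> b" for t
  proof -
    have w: "(C has_real_derivative - (\<xi> x * S x)) (at x within {a..b})"
      "(S has_real_derivative \<xi> x * C x) (at x within {a..b})" if "x \<in> {a..b}" for x
      using dC[of x] dS[of x] that has_field_derivative_at_within by auto
    have "\<exists>k. \<forall>x\<in>{a..b}. C x * cos (\<phi> x) + S x * sin (\<phi> x) = k"
      by (rule has_field_derivative_zero_constant)
        (use d\<phi> w in \<open>auto intro!: derivative_eq_intros simp: algebra_simps\<close>)
    moreover have "\<exists>k. \<forall>x\<in>{a..b}. S x * cos (\<phi> x) - C x * sin (\<phi> x) = k"
      by (rule has_field_derivative_zero_constant)
        (use d\<phi> w in \<open>auto intro!: derivative_eq_intros simp: algebra_simps\<close>)
    moreover have "C a * cos (\<phi> a) + S a * sin (\<phi> a) = 1" "S a * cos (\<phi> a) - C a * sin (\<phi> a) = 0"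
      using p \<phi>a by (simp_all add: power2_eq_square[symmetric])
    ultimately show ?thesis using t \<open>a \<le> b\<close> by (metis atLeastAtMost_iff order_refl)
  qed
  have "C t = cos (\<phi> t) \<and> S t = sin (\<phi> t)" if t: "a \<le> t" "t \<le> b" for t
  proof -
    let ?u = "C t * cos (\<phi> t) + S t * sin (\<phi> t)" and ?w = "S t * cos (\<phi> t) - C t * sin (\<phi> t)"
    have "?u * cos (\<phi> t) - ?w * sin (\<phi> t) = C t * ((cos (\<phi> t))\<^sup>2 + (sin (\<phi> t))\<^sup>2)"
      "?u * sin (\<phi> t) + ?w * cos (\<phi> t) = S t * ((cos (\<phi> t))\<^sup>2 + (sin (\<phi> t))\<^sup>2)"
      by algebra+
    then show ?thesis
      by (simp only: const[OF t, THEN conjunct1] const[OF t, THEN conjunct2] sin_cos_squared_add2) simp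
  qed
  then show ?thesis using p \<phi>a d\<phi> by (intro exI[of _ \<phi>]) auto
qed

text \<open>A smooth majorant of the negative part, by \<open>\<bar>x\<bar> \<le> (49/100 + x\<^sup>2) / (7/5)\<close>. With this constant its
  composition with \<open>cos\<close> has an elementary primitive and integral about \<open>0.707 * pi < 9/4\<close> over a period.\<close>

definition smooth_neg_part :: "real \<Rightarrow> real" where
  "smooth_neg_part x = ((49/100 + x\<^sup>2) / (7/5) - x) / 2"

lemma smooth_neg_part: "- x \<le> smooth_neg_part x" "0 \<le> smooth_neg_part x"
proof -
  have "0 \<le> (x - 7/10)\<^sup>2" "0 \<le> (x + 7/10)\<^sup>2" by simp_all
  then show "- x \<le> smooth_neg_part x" "0 \<le> smooth_neg_part x"
    unfolding smooth_neg_part_def power2_eq_square by (simp_all add: algebra_simps add_divide_distrib)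
qed

definition smooth_neg_part_prim :: "real \<Rightarrow> real" where
  "smooth_neg_part_prim x = ((49/100 * x + (x + sin x * cos x) / 2) / (7/5) - sin x) / 2"

lemma smooth_neg_part_prim_deriv [derivative_intros]:
  assumes "(f has_real_derivative f') (at x within A)"
  shows "((\<lambda>x. smooth_neg_part_prim (f x)) has_real_derivative smooth_neg_part (cos (f x)) * f') (at x within A)"
proof -
  have sq: "sin (f x) * sin (f x) = 1 - cos (f x) * cos (f x)"
    using sin_cos_squared_add[of "f x"] by (simp add: power2_eq_square)
  have "(smooth_neg_part_prim has_real_derivative smooth_neg_part (cos (f x))) (at (f x))"
    unfolding smooth_neg_part_prim_def smooth_neg_part_def power2_eq_square
    by (rule derivative_eq_intros refl | simp)+ (simp add: sq field_simps)
  from DERIV_chain2[OF this assms] show ?thesis .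
qed

lemma smooth_neg_part_prim_mono:
  assumes "x \<le> y" shows "smooth_neg_part_prim x \<le> smooth_neg_part_prim y"
proof (rule DERIV_nonneg_imp_nondecreasing[OF assms])
  fix z show "\<exists>w. (smooth_neg_part_prim has_real_derivative w) (at z) \<and> 0 \<le> w"
    using smooth_neg_part_prim_deriv[OF DERIV_ident, of z UNIV] smooth_neg_part(2)[of "cos z"] by auto
qed

text \<open>With the majorant (a^2 + x^2) / (2 a) of the modulus, the increment is pi (a^2 + 1/2) /
  (2 a). This is smallest at a = 1 / sqrt 2, and 7/10 is a rational neighbour of that value.\<close>

lemma smooth_neg_part_prim_period: "smooth_neg_part_prim (2 * pi) - smooth_neg_part_prim 0 \<le> 9/4"
  using pi_less_4 pi_approx by (simp add: smooth_neg_part_prim_def field_simps)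

section \<open>The scalar system: capture\<close>

text \<open>The bound is one-sided because d - g is only ever estimated from below. Keeping the
  level generic lets the same loss estimate serve both the lowest and the upper level.\<close>

definition slow :: "real \<Rightarrow> (real \<Rightarrow> real) \<Rightarrow> bool" where
  "slow \<Gamma> g \<longleftrightarrow> (\<exists>g'. \<forall>t>0. (g has_real_derivative g' t) (at t) \<and> g' t \<le> \<Gamma>)"

text \<open>The scalar shadow of the closed loop: \<open>d\<close> is the field value at the robot, \<open>C\<close> and \<open>S\<close> are the cosine
  and sine of the clockwise angle from the normal \<open>N\<close> to the velocity, \<open>\<xi>\<close> is the rate of that angle, \<open>\<Gamma>\<close>
  bounds the rates of the levels, and \<open>L\<close> is the loss of \<open>d - \<gamma>\<close> during one turn.\<close>

locale spiral =
  fixes d d1 d2 C S \<xi> \<rho> lam \<gamma>m \<gamma>s \<gamma>p :: "real \<Rightarrow> real"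
    and v \<Gamma> b\<rho> b_lam \<Delta> \<Omega> \<Delta>\<gamma> \<delta> c L :: real
    and Z :: "real \<Rightarrow> bool"
  assumes L_def: "L = b\<rho> * (9/4 * v + 2 * pi * (b_lam + \<Gamma> / \<Delta>)) / \<Omega>"
    and Z_def: "Z t \<longleftrightarrow> 0 < t \<and> \<gamma>m t \<le> d t \<and> d t \<le> \<gamma>p t"
    and d_deriv: "0 < t \<Longrightarrow> (d has_real_derivative d1 t) (at t)"
    and d1_deriv: "0 < t \<Longrightarrow> (d1 has_real_derivative d2 t) (at t)"
    and slow_m: "slow \<Gamma> \<gamma>m" and slow_s: "slow \<Gamma> \<gamma>s" and slow_p: "slow \<Gamma> \<gamma>p"
    and unit: "Z t \<Longrightarrow> (C t)\<^sup>2 + (S t)\<^sup>2 = 1"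
    and C_deriv: "Z t \<Longrightarrow> (C has_real_derivative - (\<xi> t * S t)) (at t)"
    and S_deriv: "Z t \<Longrightarrow> (S has_real_derivative \<xi> t * C t) (at t)"
    and \<xi>_cont: "Z t \<Longrightarrow> isCont \<xi> t"
    and d1_eq: "Z t \<Longrightarrow> d1 t = \<rho> t * (v * C t - lam t)"
    and \<rho>_bounds: "Z t \<Longrightarrow> \<Delta> \<le> \<rho> t \<and> \<rho> t \<le> b\<rho>"
    and lam_bound: "Z t \<Longrightarrow> \<bar>lam t\<bar> \<le> b_lam"
    and speed: "Z t \<Longrightarrow> \<bar>lam t\<bar> + \<Gamma> / \<rho> t < v"
    and rot: "Z t \<Longrightarrow> d1 t \<le> \<Gamma> \<Longrightarrow> \<Omega> \<le> \<xi> t"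
    and turn: "Z t \<Longrightarrow> S t = 0 \<Longrightarrow> C t = 1 \<Longrightarrow> \<xi> t < 0"
    and strip_neg: "Z t \<Longrightarrow> \<Gamma> \<le> d1 t \<Longrightarrow> d1 t \<le> \<Gamma> + \<delta> \<Longrightarrow> S t < 0 \<Longrightarrow> c \<le> d2 t"
    and strip_pos: "Z t \<Longrightarrow> \<Gamma> \<le> d1 t \<Longrightarrow> d1 t \<le> \<Gamma> + \<delta> \<Longrightarrow> S t > 0 \<Longrightarrow> d2 t \<le> - c"
    and strip_nz: "Z t \<Longrightarrow> \<Gamma> \<le> d1 t \<Longrightarrow> d1 t \<le> \<Gamma> + \<delta> \<Longrightarrow> S t \<noteq> 0"
    and signs: "0 \<le> \<Gamma>" "0 < \<delta>" "0 < c" "0 < \<Omega>" "0 < \<Delta>" "0 < v"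
    and loss: "L < \<Delta>\<gamma> / 2" and \<Delta>\<gamma>: "0 < \<Delta>\<gamma>"
    and gaps: "0 < t \<Longrightarrow> \<gamma>m t + \<Delta>\<gamma> \<le> \<gamma>s t \<and> \<gamma>s t + \<Delta>\<gamma> \<le> \<gamma>p t"
    and init: "\<exists>\<eta>>0. L < d \<eta> - \<gamma>m \<eta> \<and> \<gamma>m \<eta> < d \<eta>"
begin

lemma cont: "0 < t \<Longrightarrow> isCont d t" "0 < t \<Longrightarrow> isCont d1 t"
  using d_deriv d1_deriv DERIV_isCont by blast+

lemma slow_cont: "slow \<Gamma> g \<Longrightarrow> 0 < t \<Longrightarrow> isCont g t"
  unfolding slow_def using DERIV_isCont by blast

text \<open>The rate is bounded on the open interval only: it is applied to stretches that begin or
  end at a time where \<open>d1\<close> may be below \<Gamma>.\<close>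

lemma rising:
  assumes "slow \<Gamma> g" "0 < a" "a \<le> b" "\<And>t. a < t \<Longrightarrow> t < b \<Longrightarrow> \<Gamma> + m \<le> d1 t"
  shows "d a - g a + m * (b - a) \<le> d b - g b"
proof -
  obtain g' where g': "\<And>t. t > 0 \<Longrightarrow> (g has_real_derivative g' t) (at t)" "\<And>t. t > 0 \<Longrightarrow> g' t \<le> \<Gamma>"
    using assms(1) by (auto simp: slow_def)
  have "d a - g a - m * a \<le> d b - g b - m * b"
  proof (rule DERIV_nonneg_imp_increasing_open[OF \<open>a \<le> b\<close>])
    fix x assume x: "a < x" "x < b"
    then show "\<exists>y. ((\<lambda>x. d x - g x - m * x) has_real_derivative y) (at x) \<and> 0 \<le> y"
      using d_deriv[of x] g'[of x] assms(2) assms(4)[of x]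
      by (intro exI[of _ "d1 x - g' x - m"]) (auto intro!: derivative_eq_intros)
  next
    show "continuous_on {a..b} (\<lambda>x. d x - g x - m * x)"
      using cont(1) slow_cont[OF assms(1)] assms(2)
      by (intro continuous_at_imp_continuous_on ballI continuous_intros) auto
  qed
  then show ?thesis by (simp add: algebra_simps)
qed

text \<open>Once \<open>d1\<close> is above \<open>\<Gamma>\<close> with \<open>S < 0\<close>, it stays so: the boundary piece \<open>d1 = \<Gamma>\<close> repels by
  condition (b), the piece \<open>S = 0\<close> by condition (c).\<close>

definition captured :: "real \<Rightarrow> bool" where
  "captured t \<longleftrightarrow> \<Gamma> \<le> d1 t \<and> S t < 0"

lemma captured_persists:
  assumes Z: "\<And>t. a \<le> t \<Longrightarrow> t \<le> b \<Longrightarrow> Z t" and "captured a" and x: "a \<le> x" "x \<le> b"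
  shows "captured x"
proof (rule real_interval_induct[of a b captured])
  fix u assume u: "a \<le> u" "u < b" and cap: "captured u"
  have Zu: "Z u" and u0: "0 < u" using Z u by (auto simp: Z_def)
  have "isCont (\<lambda>x. - S x) u"
    using DERIV_isCont[OF S_deriv[OF Zu]] by (intro continuous_intros)
  then obtain e1 where e1: "e1 > 0" "\<And>x. \<bar>x - u\<bar> < e1 \<Longrightarrow> S x < 0"
    using isCont_less_nbhd[of u "\<lambda>x. - S x" 0] cap by (auto simp: captured_def)
  obtain e2 where e2: "e2 > 0" "\<And>x. u < x \<Longrightarrow> x < u + e2 \<Longrightarrow> \<Gamma> \<le> d1 x"
  proof (cases "d1 u = \<Gamma>")
    case True
    then have "d2 u > 0" using strip_neg[OF Zu] cap signs by (auto simp: captured_def)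
    then obtain e where "e > 0" "\<And>h. h > 0 \<Longrightarrow> h < e \<Longrightarrow> d1 u < d1 (u + h)"
      using DERIV_pos_inc_right[OF d1_deriv[OF u0]] by auto
    moreover have "\<Gamma> \<le> d1 x" if "u < x" "x < u + e" for x
      using calculation(2)[of "x - u"] that True by simp
    ultimately show ?thesis using that by blast
  next
    case False
    then obtain e where "e > 0" "\<And>x. \<bar>x - u\<bar> < e \<Longrightarrow> \<Gamma> < d1 x"
      using isCont_less_nbhd[OF cont(2)[OF u0], of \<Gamma>] cap by (auto simp: captured_def)
    then show ?thesis using that[of e] by (smt (verit))
  qed
  show "\<exists>e>0. \<forall>x. u < x \<and> x < u + e \<longrightarrow> captured x"
    using e1 e2 by (intro exI[of _ "min e1 e2"]) (auto simp: captured_def)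
next
  fix u assume u: "a < u" "u \<le> b" and cap: "\<And>x. a \<le> x \<Longrightarrow> x < u \<Longrightarrow> captured x"
  have Zu: "Z u" and u0: "0 < u" using Z u by (auto simp: Z_def)
  have d1u: "\<Gamma> \<le> d1 u"
    using le_left_limit[OF cont(2)[OF u0] u(1)] cap by (auto simp: captured_def)
  have "isCont (\<lambda>x. - S x) u"
    using DERIV_isCont[OF S_deriv[OF Zu]] by (intro continuous_intros)
  then have "S u \<le> 0"
    using le_left_limit[of u "\<lambda>x. - S x" a 0] u(1) cap by (auto simp: captured_def less_imp_le)
  \<comment> \<open>Where \<open>S\<close> vanishes the velocity is normal. Pointing against the
    gradient it would make \<open>d1\<close> negative, so \<open>C\<close> = 1. There
    \<open>turn\<close> gives \<open>S\<close> a negative derivative, so \<open>S\<close> would be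
    positive just before \<open>u\<close>, contrary to capture.\<close>
  moreover have "S u \<noteq> 0"
  proof
    assume Su: "S u = 0"
    have \<rho>: "\<rho> u > 0" using \<rho>_bounds[OF Zu] signs by linarith
    have "C u = 1 \<or> C u = -1" using unit[OF Zu] Su by (simp add: power2_eq_1_iff)
    moreover have "C u \<noteq> -1"
    proof
      assume "C u = -1"
      then have "d1 u = - \<rho> u * (v + lam u)" using d1_eq[OF Zu] by (simp add: algebra_simps)
      moreover have "v + lam u > 0" using speed[OF Zu] signs \<rho> by (smt (verit) divide_nonneg_pos)
      ultimately show False using d1u \<rho> signs by (smt (verit) mult_pos_pos mult_minus_left)
    qed
    ultimately have "C u = 1" by simp
    then have "\<xi> u * C u < 0" using turn[OF Zu Su] by simp
    from DERIV_neg_dec_left[OF S_deriv[OF Zu] this] obtain e where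
      e: "e > 0" "\<And>h. h > 0 \<Longrightarrow> h < e \<Longrightarrow> S u < S (u - h)" by auto
    define h where "h = min (e / 2) (u - a)"
    have "h > 0" "h < e" "a \<le> u - h" using e(1) u by (auto simp: h_def)
    then show False using e(2)[of h] cap[of "u - h"] Su by (auto simp: captured_def)
  qed
  ultimately show "captured u" using d1u by (auto simp: captured_def)
qed (use assms in auto)

text \<open>Consider the last time \<open>u\<close> with \<open>d1\<close> at most \<Gamma>. There
  \<open>d1\<close> equals \<Gamma> and cannot be decreasing, which rules out \<open>S\<close> > 0
  by \<open>strip_pos\<close>; \<open>S\<close> = 0 is impossible in the strip. So the rate can rise
  through \<Gamma> only by entering the captured state.\<close>

lemma crossing_captured:
  assumes Z: "\<And>t. a \<le> t \<Longrightarrow> t \<le> w \<Longrightarrow> Z t" and "a \<le> w" "d1 a \<le> \<Gamma>" "\<Gamma> < d1 w"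
  obtains u where "a \<le> u" "u < w" "captured u"
proof -
  let ?B = "{a..w} \<inter> d1 -` {..\<Gamma>}"
  have "continuous_on {a..w} d1"
    using cont(2) Z by (intro continuous_at_imp_continuous_on) (auto simp: Z_def)
  then have "closed ?B" by (intro continuous_closed_preimage) auto
  moreover have "bounded ?B" by (rule bounded_subset[OF bounded_closed_interval]) auto
  ultimately have "compact ?B" by (simp add: compact_eq_bounded_closed)
  moreover have "a \<in> ?B" using assms by auto
  ultimately obtain u where u: "u \<in> ?B" "\<And>x. x \<in> ?B \<Longrightarrow> x \<le> u"
    using compact_attains_sup[of ?B] by blast
  have "u \<noteq> w" using u assms by auto
  then have uw: "a \<le> u" "u < w" using u by auto
  have Zu: "Z u" and u0: "0 < u" using Z[of u] uw by (auto simp: Z_def)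
  have above: "\<Gamma> < d1 x" if "u < x" "x \<le> w" for x using u(2)[of x] uw that by force
  have eq: "d1 u = \<Gamma>"
  proof (rule ccontr)
    assume "d1 u \<noteq> \<Gamma>"
    moreover have "isCont (\<lambda>x. - d1 x) u" using cont(2)[OF u0] by (intro continuous_intros)
    ultimately obtain e where e: "e > 0" "\<And>x. \<bar>x - u\<bar> < e \<Longrightarrow> d1 x < \<Gamma>"
      using isCont_less_nbhd[of u "\<lambda>x. - d1 x" "- \<Gamma>"] u(1) by auto
    define x where "x = min (u + e/2) w"
    have "u < x" "x \<le> w" "\<bar>x - u\<bar> < e" using e(1) uw by (auto simp: x_def min_def)
    then show False using e(2)[of x] above[of x] by simp
  qed
  have "\<not> d2 u < 0"
  proof
    assume "d2 u < 0"
    from DERIV_neg_dec_right[OF d1_deriv[OF u0] this] obtain e where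
      e: "e > 0" "\<And>h. h > 0 \<Longrightarrow> h < e \<Longrightarrow> d1 (u + h) < d1 u" by auto
    define h where "h = min (e / 2) (w - u)"
    have "h > 0" "h < e" "u + h \<le> w" using e(1) uw by (auto simp: h_def)
    then show False using e(2)[of h] above[of "u + h"] eq by auto
  qed
  then have "captured u"
    using strip_pos[OF Zu] strip_nz[OF Zu] eq signs unfolding captured_def
    by (smt (verit))
  then show ?thesis using that uw by blast
qed

section \<open>The scalar system: loss inside the working zone\<close>

lemma b\<rho>_nonneg: "Z t \<Longrightarrow> 0 \<le> b\<rho>"
  using \<rho>_bounds[of t] signs by linarith

text \<open>While \<open>d1 \<le> \<Gamma>\<close>, the angle \<open>\<phi>\<close> from the normal to the velocity increases at rate at least \<open>\<Omega>\<close> and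
  cannot pass \<open>2 * pi\<close>, where the velocity is normal and so \<open>d1 > \<Gamma>\<close>.\<close>

lemma slow_phase:
  assumes Z: "\<And>t. a \<le> t \<Longrightarrow> t \<le> b \<Longrightarrow> Z t" and "a \<le> b"
    and low: "\<And>t. a \<le> t \<Longrightarrow> t \<le> b \<Longrightarrow> d1 t \<le> \<Gamma>"
  shows "\<Omega> * (b - a) \<le> 2 * pi" and "slow \<Gamma> g \<Longrightarrow> d a - g a - L \<le> d b - g b"
proof -
  have "continuous_on {a..b} \<xi>"
    using \<xi>_cont Z by (intro continuous_at_imp_continuous_on) auto
  with angle_lift[of a b C S \<xi>] \<open>a \<le> b\<close> unit C_deriv S_deriv Z
  have "\<exists>\<phi>. 0 \<le> \<phi> a \<and> \<phi> a < 2 * pi \<and>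
    (\<forall>t\<in>{a..b}. (\<phi> has_real_derivative \<xi> t) (at t within {a..b}) \<and>
      C t = cos (\<phi> t) \<and> S t = sin (\<phi> t))"
    by blast
  then obtain \<phi> where \<phi>a: "0 \<le> \<phi> a" "\<phi> a < 2 * pi"
    and d\<phi>: "\<And>t. a \<le> t \<Longrightarrow> t \<le> b \<Longrightarrow> (\<phi> has_real_derivative \<xi> t) (at t within {a..b})"
    and CS: "\<And>t. a \<le> t \<Longrightarrow> t \<le> b \<Longrightarrow> C t = cos (\<phi> t) \<and> S t = sin (\<phi> t)"
    by (elim exE) force
  have cont\<phi>: "continuous_on {a..b} \<phi>"
    using DERIV_continuous_on d\<phi> by (metis atLeastAtMost_iff)
  have d\<phi>': "(\<phi> has_real_derivative \<xi> t) (at t)" if "a < t" "t < b" for t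
    using d\<phi>[of t] that by (simp add: at_within_Icc_at)
  have C1: "C t \<noteq> 1" if t: "a \<le> t" "t \<le> b" for t
  proof
    assume "C t = 1"
    then have "d1 t = \<rho> t * (v - lam t)" using d1_eq Z t by simp
    moreover have "\<rho> t > 0" using \<rho>_bounds[OF Z[OF t]] signs by linarith
    moreover have "\<Gamma> / \<rho> t < v - lam t" using speed[OF Z[OF t]] by linarith
    ultimately show False using low[OF t] by (simp add: field_simps)
  qed
  have \<phi>_ub: "\<phi> b < 2 * pi"
  proof (rule ccontr)
    assume "\<not> \<phi> b < 2 * pi"
    then obtain t where "a \<le> t" "t \<le> b" "\<phi> t = 2 * pi"
      using IVT'[of \<phi> a "2 * pi" b] \<phi>a \<open>a \<le> b\<close> cont\<phi> by auto
    then show False using C1[of t] CS[of t] by simp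
  qed
  have "\<phi> a - \<Omega> * a \<le> \<phi> b - \<Omega> * b"
  proof (rule DERIV_nonneg_imp_increasing_open[OF \<open>a \<le> b\<close>])
    fix x assume x: "a < x" "x < b"
    then show "\<exists>y. ((\<lambda>x. \<phi> x - \<Omega> * x) has_real_derivative y) (at x) \<and> 0 \<le> y"
      using d\<phi>'[of x] rot[of x] Z[of x] low[of x]
      by (intro exI[of _ "\<xi> x - \<Omega>"]) (auto intro!: derivative_eq_intros)
  qed (intro continuous_intros cont\<phi>)
  then have mono: "\<Omega> * (b - a) \<le> \<phi> b - \<phi> a" by (simp add: algebra_simps)
  then show "\<Omega> * (b - a) \<le> 2 * pi" using \<phi>a \<phi>_ub by linarith
  assume "slow \<Gamma> g"
  then obtain g' where g': "\<And>t. t > 0 \<Longrightarrow> (g has_real_derivative g' t) (at t)" "\<And>t. t > 0 \<Longrightarrow> g' t \<le> \<Gamma>"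
    by (auto simp: slow_def)
  define Y where "Y = b_lam + \<Gamma> / \<Delta>"
  have Za: "Z a" using Z \<open>a \<le> b\<close> by auto
  have Y: "0 \<le> Y" and b\<rho>: "0 \<le> b\<rho>"
    using lam_bound[OF Za] signs b\<rho>_nonneg[OF Za] by (auto simp: Y_def)
  \<comment> \<open>A potential in the angle that pays for the loss: by the chain rule its time
    derivative is the loss bound \<open>b\<rho>\<close> * \<open>?G\<close> times \<xi> / \<Omega>,
    and this factor is at least 1 during the slow phase. Its total increment over one turn is
    \<open>L\<close>.\<close>
  define pot where "pot x = b\<rho> / \<Omega> * (v * smooth_neg_part_prim (\<phi> x) + Y * \<phi> x)" for x
  have "d a - g a + pot a \<le> d b - g b + pot b"
  proof (rule DERIV_nonneg_imp_increasing_open[OF \<open>a \<le> b\<close>])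
    fix x assume x: "a < x" "x < b"
    have Zx: "Z x" and x0: "0 < x" using Z[of x] x by (auto simp: Z_def)
    let ?G = "v * smooth_neg_part (cos (\<phi> x)) + Y"
    have G: "0 \<le> ?G" using Y signs smooth_neg_part(2)[of "cos (\<phi> x)"] by simp
    have "((\<lambda>x. d x - g x + pot x) has_real_derivative
        d1 x - g' x + b\<rho> / \<Omega> * (v * (smooth_neg_part (cos (\<phi> x)) * \<xi> x) + Y * \<xi> x)) (at x)"
      unfolding pot_def
      by (rule derivative_eq_intros d_deriv[OF x0] g'(1)[OF x0] d\<phi>'[OF x] refl | simp)+
    moreover have "b\<rho> / \<Omega> * (v * (smooth_neg_part (cos (\<phi> x)) * \<xi> x) + Y * \<xi> x) \<ge> b\<rho> * ?G"
    proof -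
      have "b\<rho> * ?G * \<Omega> \<le> b\<rho> * ?G * \<xi> x"
        using rot[OF Zx] low[of x] x b\<rho> G by (intro mult_left_mono) auto
      then show ?thesis using signs by (simp add: field_simps)
    qed
    moreover have "d1 x \<ge> \<Gamma> - b\<rho> * ?G"
    proof -
      have \<rho>: "\<Delta> \<le> \<rho> x" "\<rho> x \<le> b\<rho>" "0 < \<rho> x" using \<rho>_bounds[OF Zx] signs by auto
      have "- v * smooth_neg_part (cos (\<phi> x)) \<le> v * cos (\<phi> x)"
        using mult_left_mono[OF smooth_neg_part(1)[of "cos (\<phi> x)"], of v] signs by simp
      then have "\<rho> x * (v * C x - lam x) \<ge> \<rho> x * (- v * smooth_neg_part (cos (\<phi> x)) - b_lam)"
        using lam_bound[OF Zx] \<rho> CS[of x] x by (intro mult_left_mono) auto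
      \<comment> \<open>This charges the rate of the level to \<rho> as well, so that the whole
        deficit becomes \<rho> * \<open>?G\<close> and can be enlarged to \<open>b\<rho>\<close> *
        \<open>?G\<close> in one step.\<close>
      moreover have "\<Gamma> \<le> \<rho> x * (\<Gamma> / \<Delta>)"
        using mult_right_mono[OF \<rho>(1) signs(1)] signs by (simp add: field_simps)
      ultimately have "d1 x - \<Gamma> \<ge> - (\<rho> x * ?G)"
        using d1_eq[OF Zx] by (simp add: Y_def algebra_simps)
      moreover have "\<rho> x * ?G \<le> b\<rho> * ?G" using \<rho> G by (intro mult_right_mono)
      ultimately show ?thesis by linarith
    qed
    ultimately show "\<exists>y. ((\<lambda>x. d x - g x + pot x) has_real_derivative y) (at x) \<and> 0 \<le> y"
      using g'(2)[OF x0] by (smt (verit))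
  next
    have "continuous_on {a..b} (\<lambda>x. smooth_neg_part_prim (\<phi> x))"
      unfolding smooth_neg_part_prim_def by (intro continuous_intros cont\<phi>) auto
    moreover have "continuous_on {a..b} d" "continuous_on {a..b} g"
      using Z cont(1) slow_cont[OF \<open>slow \<Gamma> g\<close>]
      by (auto intro!: continuous_at_imp_continuous_on simp: Z_def)
    ultimately show "continuous_on {a..b} (\<lambda>x. d x - g x + pot x)"
      unfolding pot_def by (intro continuous_intros cont\<phi>)
  qed
  moreover have "pot b - pot a \<le> L"
  proof -
    have "\<phi> a \<le> \<phi> b" using mono signs \<open>a \<le> b\<close> by (smt (verit) mult_nonneg_nonneg)
    then have "smooth_neg_part_prim (\<phi> b) - smooth_neg_part_prim (\<phi> a) \<le> 9/4"
      using smooth_neg_part_prim_mono[of 0 "\<phi> a"] smooth_neg_part_prim_mono[of "\<phi> b" "2 * pi"]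
        \<phi>a \<phi>_ub smooth_neg_part_prim_period by linarith
    then have "v * (smooth_neg_part_prim (\<phi> b) - smooth_neg_part_prim (\<phi> a)) \<le> v * (9/4)"
      using signs by (intro mult_left_mono) auto
    moreover have "Y * (\<phi> b - \<phi> a) \<le> Y * (2 * pi)"
      using \<phi>a \<phi>_ub Y by (intro mult_left_mono) auto
    ultimately have "b\<rho> / \<Omega> * (v * (smooth_neg_part_prim (\<phi> b) - smooth_neg_part_prim (\<phi> a)) + Y * (\<phi> b - \<phi> a))
        \<le> b\<rho> / \<Omega> * (v * (9/4) + Y * (2 * pi))"
      using b\<rho> signs \<phi>a \<phi>_ub Y by (intro mult_left_mono add_mono) auto
    moreover have "L = b\<rho> / \<Omega> * (v * (9/4) + Y * (2 * pi))"
      by (simp add: L_def Y_def mult.commute)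
    moreover have "pot b - pot a =
        b\<rho> / \<Omega> * (v * (smooth_neg_part_prim (\<phi> b) - smooth_neg_part_prim (\<phi> a)) + Y * (\<phi> b - \<phi> a))"
      unfolding pot_def by (simp add: right_diff_distrib distrib_left)
    ultimately show ?thesis by simp
  qed
  ultimately show "d a - g a - L \<le> d b - g b" by linarith
qed

text \<open>The bound does not depend on the length of the stay, because only one slow phase can
  occur. Up to the first time with \<open>d1\<close> at most \<Gamma> nothing is lost; the slow
  phase that follows costs at most \<open>L\<close>; it can end only by capture, after which nothing
  is lost again.\<close>

lemma loss_bound:
  assumes Z: "\<And>t. a \<le> t \<Longrightarrow> t \<le> b \<Longrightarrow> Z t" and "a \<le> b" and g: "slow \<Gamma> g"
  shows "d a - g a - L \<le> d b - g b"
proof -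
  have a0: "0 < a" and b\<rho>: "0 \<le> b\<rho>" and bl: "0 \<le> b_lam"
    using Z[of a] b\<rho>_nonneg[of a] lam_bound[of a] \<open>a \<le> b\<close> by (auto simp: Z_def)
  have L: "0 \<le> L" unfolding L_def using signs b\<rho> bl by simp
  have from_low: "d w - g w - L \<le> d b - g b" if w: "a \<le> w" "w \<le> b" "d1 w \<le> \<Gamma>" for w
  proof (cases "\<forall>t\<in>{w..b}. d1 t \<le> \<Gamma>")
    case True
    then show ?thesis using slow_phase(2)[of w b g] Z w g by auto
  next
    case False
    define B where "B = {t. w \<le> t \<and> t \<le> b \<and> \<Gamma> < d1 t}"
    have ne: "B \<noteq> {}" and bdd: "bdd_below B" using False by (auto simp: B_def bdd_below_def)
    define u where "u = Inf B"
    have wu: "w \<le> u" unfolding u_def using ne by (intro cInf_greatest) (auto simp: B_def)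
    have ub: "u \<le> b"
    proof -
      obtain y where "y \<in> B" using ne by blast
      then show ?thesis using cInf_lower[OF _ bdd, of y] by (auto simp: B_def u_def)
    qed
    have u0: "0 < u" using a0 w wu by simp
    have below: "d1 t \<le> \<Gamma>" if "w \<le> t" "t < u" for t
      using cInf_lower[OF _ bdd, of t] that ub unfolding u_def B_def by force
    have "d1 u \<le> \<Gamma>"
    proof (cases "u = w")
      case False
      have "isCont (\<lambda>x. - d1 x) u" using cont(2)[OF u0] by (intro continuous_intros)
      then show ?thesis
        using le_left_limit[of u "\<lambda>x. - d1 x" w "- \<Gamma>"] below wu False by auto
    qed (use w in simp)
    then have "d1 t \<le> \<Gamma>" if "w \<le> t" "t \<le> u" for t
      using below[of t] that by (cases "t = u") auto
    moreover have "Z t" if "w \<le> t" "t \<le> u" for t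
      using Z[of t] w ub that by auto
    ultimately have low: "d w - g w - L \<le> d u - g u"
      by (intro slow_phase(2) wu g) auto
    \<comment> \<open>As \<open>u\<close> is the infimum of \<open>B\<close>, some \<open>y\<close>
      in \<open>B\<close> lies before \<open>t\<close>. The rate crosses \<Gamma> between
      \<open>w\<close> and \<open>y\<close>, so capture has happened before \<open>t\<close> and
      persists.\<close>
    have high: "\<Gamma> \<le> d1 t" if t: "u < t" "t < b" for t
    proof -
      have "\<exists>y\<in>B. y < t"
      proof (rule ccontr)
        assume "\<not> (\<exists>y\<in>B. y < t)"
        then have "t \<le> Inf B" using ne by (intro cInf_greatest) auto
        then show False using t by (simp add: u_def)
      qed
      then obtain y where y: "w \<le> y" "y \<le> b" "\<Gamma> < d1 y" "y < t" by (auto simp: B_def)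
      have "Z x" if "w \<le> x" "x \<le> y" for x using Z[of x] w y that by auto
      then obtain u' where u': "w \<le> u'" "u' < y" "captured u'"
        using crossing_captured[of w y] w y by auto
      have "captured t" by (rule captured_persists[of u' b]) (use Z w y t u' in auto)
      then show ?thesis by (simp add: captured_def)
    qed
    have "d u - g u + 0 * (b - u) \<le> d b - g b"
      by (rule rising) (use g u0 ub high in auto)
    then show ?thesis using low by simp
  qed
  show ?thesis
  proof (cases "\<exists>w\<in>{a..b}. d1 w \<le> \<Gamma>")
    case False
    have "d a - g a + 0 * (b - a) \<le> d b - g b"
      by (rule rising) (use g a0 \<open>a \<le> b\<close> False in \<open>auto simp: not_le less_imp_le\<close>)
    then show ?thesis using L by simp
  next
    case True
    define B where "B = {t. a \<le> t \<and> t \<le> b \<and> d1 t \<le> \<Gamma>}"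
    have "continuous_on {a..b} d1"
      using cont(2) a0 by (intro continuous_at_imp_continuous_on) auto
    then have "closed ({a..b} \<inter> d1 -` {..\<Gamma>})" by (intro continuous_closed_preimage) auto
    moreover have "{a..b} \<inter> d1 -` {..\<Gamma>} = B" by (auto simp: B_def)
    moreover have "bounded B" by (rule bounded_subset[OF bounded_closed_interval, of _ a b]) (auto simp: B_def)
    ultimately have "compact B" by (simp add: compact_eq_bounded_closed)
    moreover have "B \<noteq> {}" using True by (auto simp: B_def)
    ultimately obtain w where w: "w \<in> B" "\<And>x. x \<in> B \<Longrightarrow> w \<le> x"
      using compact_attains_inf[of B] by blast
    have "d a - g a + 0 * (w - a) \<le> d w - g w"
    proof (rule rising)
      fix t assume "a < t" "t < w"
      then show "\<Gamma> + 0 \<le> d1 t" using w(2)[of t] w(1) by (force simp: B_def)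
    qed (use g a0 w in \<open>auto simp: B_def\<close>)
    then show ?thesis using from_low[of w] w by (auto simp: B_def)
  qed
qed

section \<open>The scalar system: reaching the upper level and staying above the desired one\<close>

lemma first_crossing:
  assumes "0 < a" "a \<le> b" "slow \<Gamma> g" "g a < d a" "d b \<le> g b"
  obtains u where "a < u" "u \<le> b" "d u = g u" "\<And>t. a \<le> t \<Longrightarrow> t \<le> u \<Longrightarrow> g t \<le> d t"
proof -
  define f where "f t = d t - g t" for t
  have cf: "continuous_on {a..b} f"
    unfolding f_def using cont(1) slow_cont[OF assms(3)] assms(1)
    by (intro continuous_at_imp_continuous_on ballI continuous_intros) auto
  then have "closed ({a..b} \<inter> f -` {..0})" by (intro continuous_closed_preimage) auto
  moreover have "bounded ({a..b} \<inter> f -` {..0})"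
    by (rule bounded_subset[OF bounded_closed_interval, of _ a b]) auto
  ultimately have "compact ({a..b} \<inter> f -` {..0})" by (simp add: compact_eq_bounded_closed)
  moreover have "b \<in> {a..b} \<inter> f -` {..0}" using assms by (auto simp: f_def)
  ultimately obtain u where u: "u \<in> {a..b} \<inter> f -` {..0}"
    and min: "\<And>x. x \<in> {a..b} \<inter> f -` {..0} \<Longrightarrow> u \<le> x"
    using compact_attains_inf[of "{a..b} \<inter> f -` {..0}"] by blast
  have before: "0 < f t" if "a \<le> t" "t < u" for t using min[of t] that u by force
  have "f u = 0"
  proof (rule ccontr)
    assume "f u \<noteq> 0"
    then have "f u < 0" "0 < f a" using u assms by (auto simp: f_def)
    moreover have "continuous_on {a..u} f" using cf by (rule continuous_on_subset) (use u in auto)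
    ultimately obtain x where "a \<le> x" "x \<le> u" "f x = 0"
      using IVT2'[of f u 0 a] u by auto
    then show False using before[of x] \<open>f u < 0\<close> by (cases "x = u") auto
  qed
  moreover have "a \<noteq> u" using \<open>f u = 0\<close> assms by (auto simp: f_def)
  moreover have "g t \<le> d t" if "a \<le> t" "t \<le> u" for t
    using before[of t] that \<open>f u = 0\<close> by (cases "t = u") (auto simp: f_def)
  ultimately show ?thesis using u that[of u] by (auto simp: f_def)
qed

text \<open>Capture alone gives a rate that may approach \<Gamma>, hence no growth relative to
  \<open>\<gamma>p\<close>. In the strip, however, \<open>d1\<close> grows at rate \<open>c\<close>,
  so it reaches \<Gamma> + \<delta> within time \<delta> / c; that level is then a barrier, and d -
  \<open>\<gamma>p\<close> grows at rate at least \<delta>.\<close>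

lemma captured_escapes:
  assumes Z: "\<And>t. a \<le> t \<Longrightarrow> Z t" and "captured a"
  shows False
proof -
  have cap: "captured t" if "a \<le> t" for t
    by (rule captured_persists[of a t]) (use Z assms(2) that in auto)
  have d1d: "(d1 has_real_derivative d2 t) (at t)" if "a \<le> t" for t
    using d1_deriv Z[OF that] by (auto simp: Z_def)
  have "\<exists>t\<ge>a. \<Gamma> + \<delta> \<le> d1 t"
  proof (rule ccontr)
    assume "\<not> ?thesis"
    then have low: "d1 t < \<Gamma> + \<delta>" if "a \<le> t" for t using that by force
    define T where "T = a + \<delta> / c"
    have aT: "a \<le> T" using signs by (simp add: T_def)
    have "d1 a + c * (T - a) \<le> d1 T"
    proof (rule linear_growth[of a T d1 d2])
      fix t assume "a \<le> t" "t \<le> T"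
      then show "c \<le> d2 t" using strip_neg[of t] Z cap[of t] low[of t] by (auto simp: captured_def)
    qed (use d1d aT in auto)
    moreover have "c * (T - a) = \<delta>" using signs by (simp add: T_def)
    ultimately show False using low[of T] aT cap[of a] by (auto simp: captured_def)
  qed
  then obtain w where w: "a \<le> w" "\<Gamma> + \<delta> \<le> d1 w" by blast
  have high: "\<Gamma> + \<delta> \<le> d1 t" if "w \<le> t" for t
  proof (rule barrier[of w t d1 d2])
    fix x assume x: "w \<le> x" "x \<le> t" "d1 x = \<Gamma> + \<delta>"
    then have "c \<le> d2 x" using strip_neg[of x] Z cap[of x] w signs by (auto simp: captured_def)
    then show "0 < d2 x" using signs by simp
  qed (use d1d w that in auto)
  \<comment> \<open>The summand 1 makes d exceed \<open>\<gamma>p\<close> strictly at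
    \<open>T\<close>, which contradicts \<open>Z\<close>.\<close>
  define T where "T = w + (1 + (\<gamma>p w - d w)) / \<delta>"
  have wT: "w \<le> T" using signs Z[OF w(1)] by (simp add: T_def Z_def)
  have "0 < w" using Z[OF w(1)] by (simp add: Z_def)
  then have "d w - \<gamma>p w + \<delta> * (T - w) \<le> d T - \<gamma>p T"
    by (intro rising slow_p wT high) auto
  moreover have "\<delta> * (T - w) = 1 + (\<gamma>p w - d w)" using signs by (simp add: T_def)
  ultimately show False using Z[of T] w wT by (auto simp: Z_def)
qed

text \<open>By the previous lemma capture never occurs. A slow phase could then never end, against
  its bounded duration, so \<open>d1\<close> > \<Gamma> throughout and hence \<open>S\<close> >= 0.
  In the strip this makes \<open>d1\<close> fall at rate \<open>c\<close> down to \<Gamma>, so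
  \<open>d1\<close> must stay above \<Gamma> + \<delta>, and d overtakes
  \<open>\<gamma>p\<close>.\<close>

lemma uncaptured_escapes:
  assumes Z: "\<And>t. a \<le> t \<Longrightarrow> Z t"
  shows False
proof -
  have not_cap: "\<not> captured t" if "a \<le> t" for t
    using captured_escapes[of t] Z that by force
  have a0: "0 < a" using Z[of a] by (simp add: Z_def)
  have d1d: "(d1 has_real_derivative d2 t) (at t)" if "a \<le> t" for t
    using d1_deriv a0 that by auto
  have high: "\<Gamma> < d1 w" if aw: "a \<le> w" for w
  proof (rule ccontr)
    assume "\<not> \<Gamma> < d1 w"
    then have lw: "d1 w \<le> \<Gamma>" by simp
    have low: "d1 t \<le> \<Gamma>" if "w \<le> t" for t
      using crossing_captured[of w t] Z not_cap lw that aw by (metis not_le order_trans)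
    \<comment> \<open>The duration 7 / \<Omega> is too long because 7 > 2 pi.\<close>
    have "\<Omega> * ((w + 7 / \<Omega>) - w) \<le> 2 * pi"
      by (rule slow_phase(1)) (use Z aw low signs in auto)
    then show False using signs pi_approx by simp
  qed
  have S: "0 \<le> S t" if "a \<le> t" for t
    using not_cap[OF that] high[OF that] by (auto simp: captured_def)
  have high2: "\<Gamma> + \<delta> < d1 w" if aw: "a \<le> w" for w
  proof (rule ccontr)
    assume "\<not> \<Gamma> + \<delta> < d1 w"
    then have lw: "- (\<Gamma> + \<delta>) \<le> - d1 w" by simp
    have strip: "d2 t \<le> - c" if "w \<le> t" "d1 t \<le> \<Gamma> + \<delta>" for t
      using strip_pos[of t] strip_nz[of t] Z[of t] S[of t] high[of t] that aw by force
    have md: "((\<lambda>t. - d1 t) has_real_derivative - d2 t) (at t)" if "w \<le> t" for t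
      using d1d[of t] that aw by (auto intro!: derivative_eq_intros)
    have stay: "- (\<Gamma> + \<delta>) \<le> - d1 t" if "w \<le> t" for t
    proof (rule barrier[of w t "\<lambda>t. - d1 t" "\<lambda>t. - d2 t"])
      fix x assume "w \<le> x" "- d1 x = - (\<Gamma> + \<delta>)"
      then show "0 < - d2 x" using strip[of x] signs by auto
    qed (use md lw that in auto)
    define T where "T = w + \<delta> / c"
    have wT: "w \<le> T" using signs by (simp add: T_def)
    have "- d1 w + c * (T - w) \<le> - d1 T"
    proof (rule linear_growth[of w T "\<lambda>t. - d1 t" "\<lambda>t. - d2 t"])
      fix t assume "w \<le> t"
      then show "c \<le> - d2 t" using strip[of t] stay[of t] by auto
    qed (use md wT in auto)
    moreover have "c * (T - w) = \<delta>" using signs by (simp add: T_def)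
    ultimately show False using high[of T] wT aw lw by linarith
  qed
  define T where "T = a + (1 + (\<gamma>p a - d a)) / \<delta>"
  have aT: "a \<le> T" using signs Z[of a] by (simp add: T_def Z_def)
  have "d a - \<gamma>p a + \<delta> * (T - a) \<le> d T - \<gamma>p T"
    by (intro rising slow_p aT a0) (use high2 in \<open>auto intro: less_imp_le\<close>)
  moreover have "\<delta> * (T - a) = 1 + (\<gamma>p a - d a)" using signs by (simp add: T_def)
  ultimately show False using Z[of T] aT by (auto simp: Z_def)
qed

text \<open>As long as the upper level is not touched, the zone can be left only through
  \<open>\<gamma>m\<close>, and the initial margin over \<open>\<gamma>m\<close> is larger than the
  possible loss. So the stay would be endless.\<close>

lemma reaches_upper: "\<exists>t>0. \<gamma>p t \<le> d t"
proof (rule ccontr)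
  assume "\<not> ?thesis"
  then have up: "d t < \<gamma>p t" if "0 < t" for t using that by force
  obtain \<eta> where \<eta>: "0 < \<eta>" "L < d \<eta> - \<gamma>m \<eta>" and pos: "\<gamma>m \<eta> < d \<eta>"
    using init by blast
  have "Z t" if "\<eta> \<le> t" for t
  proof (rule ccontr)
    assume "\<not> Z t"
    then have "d t \<le> \<gamma>m t" using up[of t] \<eta> that by (auto simp: Z_def)
    then obtain u where u: "\<eta> < u" "d u = \<gamma>m u" "\<And>t. \<eta> \<le> t \<Longrightarrow> t \<le> u \<Longrightarrow> \<gamma>m t \<le> d t"
      using first_crossing[OF \<eta>(1) \<open>\<eta> \<le> t\<close> slow_m pos] by blast
    have "d \<eta> - \<gamma>m \<eta> - L \<le> d u - \<gamma>m u"
      by (rule loss_bound[OF _ _ slow_m])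
        (use u \<eta> up in \<open>auto simp: Z_def intro: less_imp_le\<close>)
    then show False using u \<eta> by simp
  qed
  then show False by (rule uncaptured_escapes)
qed

text \<open>From the last visit \<open>a\<close> to the upper level until the first descent
  \<open>u\<close> to \<open>\<gamma>s\<close> the motion stays in the zone. Meanwhile d -
  \<open>\<gamma>p\<close> would drop from 0 to at most -\<Delta>\<gamma>, although the loss is
  below \<Delta>\<gamma> / 2.\<close>

theorem eventually_above: "\<exists>t0>0. \<forall>t\<ge>t0. \<gamma>s t \<le> d t"
proof -
  obtain t0 where t0: "0 < t0" "\<gamma>p t0 \<le> d t0" using reaches_upper by blast
  have "\<gamma>s t \<le> d t" if t: "t0 \<le> t" for t
  proof (rule ccontr)
    assume bad: "\<not> \<gamma>s t \<le> d t"
    define B where "B = {t0..t} \<inter> (\<lambda>x. d x - \<gamma>p x) -` {0..}"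
    have "continuous_on {t0..t} (\<lambda>x. d x - \<gamma>p x)"
      using cont(1) slow_cont[OF slow_p] t0
      by (intro continuous_at_imp_continuous_on ballI continuous_intros) auto
    then have "closed B" unfolding B_def by (intro continuous_closed_preimage) auto
    moreover have "bounded B"
      unfolding B_def by (rule bounded_subset[OF bounded_closed_interval, of _ t0 t]) auto
    ultimately have "compact B" by (simp add: compact_eq_bounded_closed)
    moreover have "t0 \<in> B" using t0 t by (auto simp: B_def)
    ultimately obtain a where a: "a \<in> B" "\<And>x. x \<in> B \<Longrightarrow> x \<le> a"
      using compact_attains_sup[of B] by blast
    have at: "t0 \<le> a" "a \<le> t" "0 < a" "\<gamma>p a \<le> d a" using a t0 by (auto simp: B_def)
    have after: "d x \<le> \<gamma>p x" if "a < x" "x \<le> t" for x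
      using a(2)[of x] that at by (force simp: B_def)
    have eq: "d a = \<gamma>p a"
    proof (rule ccontr)
      assume ne: "d a \<noteq> \<gamma>p a"
      have "a \<noteq> t" using at bad gaps[of a] \<Delta>\<gamma> by auto
      have "isCont (\<lambda>x. d x - \<gamma>p x) a"
        using cont(1) slow_cont[OF slow_p] at(3) by (intro continuous_intros)
      then obtain e where e: "e > 0" "\<And>x. \<bar>x - a\<bar> < e \<Longrightarrow> \<gamma>p x < d x"
        using isCont_less_nbhd[of a "\<lambda>x. d x - \<gamma>p x" 0] ne at by auto
      define x where "x = min (a + e/2) t"
      have "a < x" "x \<le> t" "\<bar>x - a\<bar> < e"
        using e(1) at \<open>a \<noteq> t\<close> by (auto simp: x_def min_def)
      then show False using e(2)[of x] after[of x] by simp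
    qed
    have "\<gamma>s a < d a" "d t \<le> \<gamma>s t" using gaps[OF at(3)] at \<Delta>\<gamma> bad by auto
    then obtain u where u: "a < u" "u \<le> t" "d u = \<gamma>s u" "\<And>x. a \<le> x \<Longrightarrow> x \<le> u \<Longrightarrow> \<gamma>s x \<le> d x"
      using first_crossing[OF at(3,2) slow_s] by blast
    have "d a - \<gamma>p a - L \<le> d u - \<gamma>p u"
    proof (rule loss_bound[OF _ _ slow_p])
      fix x assume x: "a \<le> x" "x \<le> u"
      then have "0 < x" using at by simp
      moreover have "d x \<le> \<gamma>p x" using after[of x] eq x u by (cases "x = a") auto
      moreover have "\<gamma>m x \<le> d x" using u(4)[OF x] gaps[OF \<open>0 < x\<close>] \<Delta>\<gamma> by linarith
      ultimately show "Z x" by (simp add: Z_def)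
    qed (use u in simp)
    moreover have "\<gamma>s u + \<Delta>\<gamma> \<le> \<gamma>p u" using gaps[of u] u at by simp
    ultimately show False using eq u loss \<Delta>\<gamma> by linarith
  qed
  then show ?thesis using t0 by blast
qed

end

section \<open>Condition (b) made uniform in a strip of rates\<close>

text \<open>\<open>d''\<close> divided by \<open>\<rho>\<close>, as a function of the characteristics (with \<open>i = 1 / \<rho>\<close>), of \<open>S = d'\<close> and of the
  sign \<open>sg\<close> of the tangential velocity, whose modulus is determined by \<open>S\<close>.\<close>

definition tang_speed :: "real \<Rightarrow> real \<Rightarrow> real \<Rightarrow> real \<Rightarrow> real" where
  "tang_speed v i l S = sqrt (v\<^sup>2 - (l + i * S)\<^sup>2)"

definition accel ::
  "real \<Rightarrow> real \<Rightarrow> real \<Rightarrow> real \<Rightarrow> real \<times> real \<times> real \<times> real \<times> real \<times> real \<times> real \<times> real \<times> real \<Rightarrow> real" where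
  "accel v \<nu> \<mu> sg = (\<lambda>(i, l, om, ka, vr, al, ta, n, S).
     - al + 2 * vr * (i * S) + n * (i * S)\<^sup>2
     + sg * tang_speed v i l S * (- 2 * om + 2 * ta * (i * S) - ka * (sg * tang_speed v i l S) - \<mu> * (\<nu> - S)))"

lemma accel_uniformly_continuous:
  assumes "compact K"
  shows "uniformly_continuous_on K (accel v \<nu> \<mu> sg)"
proof (rule compact_uniformly_continuous[OF _ assms])
  \<comment> \<open>The function \<open>sqrt\<close> is continuous on all reals, also at negative
    arguments, so the whole box can be used, including states where the radicand is
    negative.\<close>
  show "continuous_on K (accel v \<nu> \<mu> sg)"
    unfolding accel_def tang_speed_def split_beta by (intro continuous_intros)
qed

text \<open>The width \<delta> must not depend on the state. The bounds (A3) confine the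
  characteristics to a compact box, and the variable i = 1 / \<rho> ranges over a compact interval
  as well.\<close>

lemma accel_strip:
  assumes "0 \<le> \<Gamma>" "\<Gamma> < \<nu>" "0 < c" "0 < \<Delta>"
  obtains \<delta> where "0 < \<delta>" "\<Gamma> + \<delta> \<le> \<nu>"
    "\<And>i l om ka vr al ta n S. 0 \<le> i \<Longrightarrow> i \<le> 1 / \<Delta> \<Longrightarrow> \<bar>l\<bar> \<le> bl \<Longrightarrow> \<bar>om\<bar> \<le> bo \<Longrightarrow> \<bar>ka\<bar> \<le> bk \<Longrightarrow>
       \<bar>vr\<bar> \<le> bv \<Longrightarrow> \<bar>al\<bar> \<le> ba \<Longrightarrow> \<bar>ta\<bar> \<le> bt \<Longrightarrow> \<bar>n\<bar> \<le> bn \<Longrightarrow> \<Gamma> \<le> S \<Longrightarrow> S \<le> \<Gamma> + \<delta> \<Longrightarrow>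
       \<bar>accel v \<nu> \<mu> sg (i, l, om, ka, vr, al, ta, n, S) - accel v \<nu> \<mu> sg (i, l, om, ka, vr, al, ta, n, \<Gamma>)\<bar> < c"
proof -
  define K where "K = {0..1/\<Delta>} \<times> {-bl..bl} \<times> {-bo..bo} \<times> {-bk..bk} \<times> {-bv..bv} \<times> {-ba..ba} \<times> {-bt..bt}
    \<times> {-bn..bn} \<times> {\<Gamma>..\<nu>}"
  have "compact K" unfolding K_def by (intro compact_Times compact_Icc)
  from accel_uniformly_continuous[OF this] obtain e where e: "e > 0"
    "\<And>x y. x \<in> K \<Longrightarrow> y \<in> K \<Longrightarrow> dist y x < e \<Longrightarrow>
       dist (accel v \<nu> \<mu> sg y) (accel v \<nu> \<mu> sg x) < c"
    unfolding uniformly_continuous_on_def using \<open>0 < c\<close> by metis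
  \<comment> \<open>The cap \<nu> - \<Gamma> keeps \<open>S\<close> at most \<nu>: this puts the
    state into the box and later lets condition (a) bound the tangential speed.\<close>
  show ?thesis
  proof (rule that[of "min (e / 2) (\<nu> - \<Gamma>)"])
    fix i l om ka vr al ta n S
    assume *: "0 \<le> i" "i \<le> 1 / \<Delta>" "\<bar>l\<bar> \<le> bl" "\<bar>om\<bar> \<le> bo" "\<bar>ka\<bar> \<le> bk" "\<bar>vr\<bar> \<le> bv" "\<bar>al\<bar> \<le> ba"
      "\<bar>ta\<bar> \<le> bt" "\<bar>n\<bar> \<le> bn" "\<Gamma> \<le> S" "S \<le> \<Gamma> + min (e / 2) (\<nu> - \<Gamma>)"
    then have "dist (i, l, om, ka, vr, al, ta, n, S) (i, l, om, ka, vr, al, ta, n, \<Gamma>) < e"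
      using e(1) by (simp add: dist_Pair_Pair dist_real_def)
    then show "\<bar>accel v \<nu> \<mu> sg (i, l, om, ka, vr, al, ta, n, S) - accel v \<nu> \<mu> sg (i, l, om, ka, vr, al, ta, n, \<Gamma>)\<bar> < c"
      using e(2)[of "(i, l, om, ka, vr, al, ta, n, \<Gamma>)" "(i, l, om, ka, vr, al, ta, n, S)"] * assms
      by (simp add: K_def abs_le_iff dist_real_def min_def split: if_splits)
  qed (use assms e in auto)
qed

text \<open>Condition (a) keeps the normal speed at most v - \<epsilon>, and v^2 - (v -
  \<epsilon>)^2 = v \<epsilon> + (v - \<epsilon>) \<epsilon>. The tangential velocity is therefore
  bounded away from zero and keeps a definite sign in the strip.\<close>

lemma tang_speed_ge:
  assumes "0 < \<epsilon>" "0 \<le> i" "0 \<le> S" "S \<le> \<nu>" "\<bar>l\<bar> + i * \<nu> + \<epsilon> \<le> v"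
  shows "sqrt (v * \<epsilon>) \<le> tang_speed v i l S"
proof -
  have "i * S \<le> i * \<nu>" "0 \<le> i * S" using assms by (auto intro: mult_left_mono)
  then have a: "\<bar>l + i * S\<bar> \<le> v - \<epsilon>" using assms by linarith
  have "(l + i * S)\<^sup>2 \<le> (v - \<epsilon>)\<^sup>2" using a power_mono[OF a, of 2] by simp
  moreover have "0 \<le> (v - \<epsilon>) * \<epsilon>" using a assms by (intro mult_nonneg_nonneg) linarith+
  ultimately have "v * \<epsilon> \<le> v\<^sup>2 - (l + i * S)\<^sup>2" by (simp add: power2_eq_square algebra_simps)
  then show "sqrt (v * \<epsilon>) \<le> tang_speed v i l S" by (simp add: tang_speed_def)
qed

text \<open>At S = \<Gamma> the acceleration factors as \<open>vT\<close> * (X - \<mu> (\<nu> -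
  \<Gamma>)), where X is the bracket of condition (b). The margin \<epsilon> in (b) and the lower
  bound on the modulus of \<open>vT\<close> make the estimate uniform.\<close>

lemma accel_at_level:
  assumes "0 < \<epsilon>" "0 \<le> \<Gamma>" "\<Gamma> < \<nu>" "0 < \<rho>" "\<bar>l\<bar> + \<nu> / \<rho> + \<epsilon> \<le> v" and sg: "sg = 1 \<or> sg = - 1"
    and vT: "vT = sg * tang_speed v (1 / \<rho>) l \<Gamma>"
    and b: "\<mu> \<ge> 1 / (\<nu> - \<Gamma>) *
        (- 2 * om - ka * vT + 2 * (ta * \<Gamma> / \<rho>) + 2 * (vr * \<Gamma> / (vT * \<rho>)) - al / vT
          + n * \<Gamma>\<^sup>2 / (vT * \<rho>\<^sup>2)) + \<epsilon>" (is "_ \<ge> _ * ?X + _")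
  shows "sg * accel v \<nu> \<mu> sg (1 / \<rho>, l, om, ka, vr, al, ta, n, \<Gamma>) \<le> - (sqrt (v * \<epsilon>) * (\<epsilon> * (\<nu> - \<Gamma>)))"
proof -
  let ?R = "tang_speed v (1 / \<rho>) l \<Gamma>"
  have R: "sqrt (v * \<epsilon>) \<le> ?R" using tang_speed_ge[of \<epsilon> "1 / \<rho>" \<Gamma> \<nu> l v] assms by simp
  have "v > 0" using assms by (smt (verit) divide_nonneg_pos)
  then have R0: "0 < ?R" using R \<open>0 < \<epsilon>\<close> by (smt (verit) mult_pos_pos real_sqrt_gt_zero)
  have sg2: "sg * sg = 1" using sg by auto
  have vT0: "vT \<noteq> 0" using R0 sg vT by auto
  define X where "X = ?X"
  have "accel v \<nu> \<mu> sg (1 / \<rho>, l, om, ka, vr, al, ta, n, \<Gamma>) = vT * (X - \<mu> * (\<nu> - \<Gamma>))"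
    unfolding X_def using vT0 \<open>0 < \<rho>\<close> unfolding accel_def prod.case vT[symmetric]
    by (simp add: field_simps power2_eq_square)
  then have "sg * accel v \<nu> \<mu> sg (1 / \<rho>, l, om, ka, vr, al, ta, n, \<Gamma>) = ?R * (X - \<mu> * (\<nu> - \<Gamma>))"
    by (simp only: vT mult.assoc[symmetric] sg2 mult_1)
  moreover have "X - \<mu> * (\<nu> - \<Gamma>) \<le> - (\<epsilon> * (\<nu> - \<Gamma>))"
  proof -
    have "X / (\<nu> - \<Gamma>) \<le> \<mu> - \<epsilon>" using b unfolding X_def[symmetric] by simp
    then have "X \<le> (\<mu> - \<epsilon>) * (\<nu> - \<Gamma>)" using assms(3) by (simp add: pos_divide_le_eq)
    then show ?thesis by (simp add: algebra_simps)
  qed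
  then have "?R * (X - \<mu> * (\<nu> - \<Gamma>)) \<le> ?R * - (\<epsilon> * (\<nu> - \<Gamma>))"
    using R0 by (intro mult_left_mono) auto
  moreover have "sqrt (v * \<epsilon>) * (\<epsilon> * (\<nu> - \<Gamma>)) \<le> ?R * (\<epsilon> * (\<nu> - \<Gamma>))"
    using R assms by (intro mult_right_mono) auto
  ultimately show ?thesis by simp
qed

lemma strip_estimate:
  assumes pos: "0 < v" "0 < \<epsilon>" "0 \<le> \<Gamma>" "\<Gamma> < \<nu>" "0 < \<Delta>"
  obtains \<delta> c where "0 < \<delta>" "0 < c"
    "\<And>\<rho> l om ka vr al ta n S Cp Sp. \<Delta> \<le> \<rho> \<Longrightarrow> \<bar>l\<bar> \<le> bl \<Longrightarrow> \<bar>om\<bar> \<le> bo \<Longrightarrow> \<bar>ka\<bar> \<le> bk \<Longrightarrow>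
       \<bar>vr\<bar> \<le> bv \<Longrightarrow> \<bar>al\<bar> \<le> ba \<Longrightarrow> \<bar>ta\<bar> \<le> bt \<Longrightarrow> \<bar>n\<bar> \<le> bn \<Longrightarrow> \<bar>l\<bar> + \<nu> / \<rho> + \<epsilon> \<le> v \<Longrightarrow>
       (\<And>vT. vT = sqrt (v\<^sup>2 - (l + \<Gamma> / \<rho>)\<^sup>2) \<or> vT = - sqrt (v\<^sup>2 - (l + \<Gamma> / \<rho>)\<^sup>2) \<Longrightarrow>
         \<mu> \<ge> 1 / (\<nu> - \<Gamma>) *
          (- 2 * om - ka * vT + 2 * (ta * \<Gamma> / \<rho>) + 2 * (vr * \<Gamma> / (vT * \<rho>)) - al / vT
            + n * \<Gamma>\<^sup>2 / (vT * \<rho>\<^sup>2)) + \<epsilon>) \<Longrightarrow>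
       S = \<rho> * (v * Cp - l) \<Longrightarrow> Cp\<^sup>2 + Sp\<^sup>2 = 1 \<Longrightarrow> \<Gamma> \<le> S \<Longrightarrow> S \<le> \<Gamma> + \<delta> \<Longrightarrow>
       Sp \<noteq> 0 \<and>
       (Sp < 0 \<longrightarrow> c \<le> \<rho> * (- al + 2 * vr * (S / \<rho>) + n * (S / \<rho>)\<^sup>2
          + v * Sp * (- 2 * om + 2 * ta * (S / \<rho>) - ka * (v * Sp) - \<mu> * (\<nu> - S)))) \<and>
       (Sp > 0 \<longrightarrow> \<rho> * (- al + 2 * vr * (S / \<rho>) + n * (S / \<rho>)\<^sup>2
          + v * Sp * (- 2 * om + 2 * ta * (S / \<rho>) - ka * (v * Sp) - \<mu> * (\<nu> - S))) \<le> - c)"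
proof -
  \<comment> \<open>Half of the margin available at the level; the other half is spent on the
    variation across the strip.\<close>
  define c where "c = sqrt (v * \<epsilon>) * (\<epsilon> * (\<nu> - \<Gamma>)) / 2"
  have c: "0 < c" using pos by (simp add: c_def)
  obtain \<delta>1 where \<delta>1: "0 < \<delta>1" "\<Gamma> + \<delta>1 \<le> \<nu>"
    "\<And>i l om ka vr al ta n S. 0 \<le> i \<Longrightarrow> i \<le> 1 / \<Delta> \<Longrightarrow> \<bar>l\<bar> \<le> bl \<Longrightarrow> \<bar>om\<bar> \<le> bo \<Longrightarrow> \<bar>ka\<bar> \<le> bk \<Longrightarrow>
       \<bar>vr\<bar> \<le> bv \<Longrightarrow> \<bar>al\<bar> \<le> ba \<Longrightarrow> \<bar>ta\<bar> \<le> bt \<Longrightarrow> \<bar>n\<bar> \<le> bn \<Longrightarrow> \<Gamma> \<le> S \<Longrightarrow> S \<le> \<Gamma> + \<delta>1 \<Longrightarrow>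
       \<bar>accel v \<nu> \<mu> 1 (i, l, om, ka, vr, al, ta, n, S) - accel v \<nu> \<mu> 1 (i, l, om, ka, vr, al, ta, n, \<Gamma>)\<bar> < c"
    using accel_strip[OF pos(3,4) c pos(5), of bl bo bk bv ba bt bn v \<mu> 1] by blast
  obtain \<delta>2 where \<delta>2: "0 < \<delta>2" "\<Gamma> + \<delta>2 \<le> \<nu>"
    "\<And>i l om ka vr al ta n S. 0 \<le> i \<Longrightarrow> i \<le> 1 / \<Delta> \<Longrightarrow> \<bar>l\<bar> \<le> bl \<Longrightarrow> \<bar>om\<bar> \<le> bo \<Longrightarrow> \<bar>ka\<bar> \<le> bk \<Longrightarrow>
       \<bar>vr\<bar> \<le> bv \<Longrightarrow> \<bar>al\<bar> \<le> ba \<Longrightarrow> \<bar>ta\<bar> \<le> bt \<Longrightarrow> \<bar>n\<bar> \<le> bn \<Longrightarrow> \<Gamma> \<le> S \<Longrightarrow> S \<le> \<Gamma> + \<delta>2 \<Longrightarrow>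
       \<bar>accel v \<nu> \<mu> (- 1) (i, l, om, ka, vr, al, ta, n, S) - accel v \<nu> \<mu> (- 1) (i, l, om, ka, vr, al, ta, n, \<Gamma>)\<bar> < c"
    using accel_strip[OF pos(3,4) c pos(5), of bl bo bk bv ba bt bn v \<mu> "- 1"] by blast
  \<comment> \<open>One width has to serve both signs of the tangential velocity. The factor
    \<Delta> turns the estimate for d'' / \<rho> into one for d''.\<close>
  show ?thesis
  proof (rule that[of "min \<delta>1 \<delta>2" "\<Delta> * c"])
    fix \<rho> l om ka vr al ta n S Cp Sp
    assume *: "\<Delta> \<le> \<rho>" and bounds: "\<bar>l\<bar> \<le> bl" "\<bar>om\<bar> \<le> bo" "\<bar>ka\<bar> \<le> bk"
       "\<bar>vr\<bar> \<le> bv" "\<bar>al\<bar> \<le> ba" "\<bar>ta\<bar> \<le> bt" "\<bar>n\<bar> \<le> bn" and sp: "\<bar>l\<bar> + \<nu> / \<rho> + \<epsilon> \<le> v"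
       and b: "\<And>vT. vT = sqrt (v\<^sup>2 - (l + \<Gamma> / \<rho>)\<^sup>2) \<or> vT = - sqrt (v\<^sup>2 - (l + \<Gamma> / \<rho>)\<^sup>2) \<Longrightarrow>
         \<mu> \<ge> 1 / (\<nu> - \<Gamma>) *
          (- 2 * om - ka * vT + 2 * (ta * \<Gamma> / \<rho>) + 2 * (vr * \<Gamma> / (vT * \<rho>)) - al / vT
            + n * \<Gamma>\<^sup>2 / (vT * \<rho>\<^sup>2)) + \<epsilon>"
       and S: "S = \<rho> * (v * Cp - l)" and unit: "Cp\<^sup>2 + Sp\<^sup>2 = 1"
       and lo: "\<Gamma> \<le> S" and hi: "S \<le> \<Gamma> + min \<delta>1 \<delta>2"
    let ?E = "- al + 2 * vr * (S / \<rho>) + n * (S / \<rho>)\<^sup>2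
          + v * Sp * (- 2 * om + 2 * ta * (S / \<rho>) - ka * (v * Sp) - \<mu> * (\<nu> - S))"
    have \<rho>: "0 < \<rho>" using * pos by linarith
    have i: "0 \<le> 1 / \<rho>" "1 / \<rho> \<le> 1 / \<Delta>" using * pos \<rho> by (auto simp: frac_le)
    have vN: "v * Cp = l + 1 / \<rho> * S" using S \<rho> by (simp add: field_simps)
    let ?R = "tang_speed v (1 / \<rho>) l S"
    have R: "sqrt (v * \<epsilon>) \<le> ?R"
      using tang_speed_ge[of \<epsilon> "1 / \<rho>" S \<nu> l v] i pos lo hi \<delta>1 sp by simp
    then have R0: "0 < ?R" using pos by (smt (verit) mult_pos_pos real_sqrt_gt_zero)
    have "v\<^sup>2 - (l + 1 / \<rho> * S)\<^sup>2 = v\<^sup>2 * (1 - Cp\<^sup>2)" unfolding vN[symmetric]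
      by (simp add: power_mult_distrib algebra_simps)
    also have "1 - Cp\<^sup>2 = Sp\<^sup>2" using unit by simp
    finally have RS: "?R = v * \<bar>Sp\<bar>"
      using pos by (simp add: tang_speed_def real_sqrt_mult)
    have main: "sg * ?E \<le> - c" if sg: "sg = 1 \<or> sg = - 1" "v * Sp = sg * ?R" for sg
    proof -
      have eq: "?E = accel v \<nu> \<mu> sg (1 / \<rho>, l, om, ka, vr, al, ta, n, S)"
        unfolding accel_def prod.case sg(2)[symmetric] by simp
      have "sg * accel v \<nu> \<mu> sg (1 / \<rho>, l, om, ka, vr, al, ta, n, \<Gamma>) \<le> - (2 * c)"
      proof -
        have "sg * tang_speed v (1 / \<rho>) l \<Gamma> = sqrt (v\<^sup>2 - (l + \<Gamma> / \<rho>)\<^sup>2) \<or>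
            sg * tang_speed v (1 / \<rho>) l \<Gamma> = - sqrt (v\<^sup>2 - (l + \<Gamma> / \<rho>)\<^sup>2)"
          using sg(1) by (auto simp: tang_speed_def)
        from accel_at_level[OF pos(2,3,4) \<rho> sp sg(1) refl b[OF this]] show ?thesis
          by (simp only: c_def)
      qed
      moreover have "\<bar>accel v \<nu> \<mu> sg (1 / \<rho>, l, om, ka, vr, al, ta, n, S)
          - accel v \<nu> \<mu> sg (1 / \<rho>, l, om, ka, vr, al, ta, n, \<Gamma>)\<bar> < c"
        using sg(1) \<delta>1(3)[OF i bounds lo] \<delta>2(3)[OF i bounds lo] hi by auto
      ultimately show ?thesis unfolding eq using sg(1) by auto
    qed
    have scale: "\<Delta> * c \<le> \<rho> * c" using * c by simp
    show "Sp \<noteq> 0 \<and> (Sp < 0 \<longrightarrow> \<Delta> * c \<le> \<rho> * ?E) \<and> (Sp > 0 \<longrightarrow> \<rho> * ?E \<le> - (\<Delta> * c))"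
    proof (intro conjI impI)
      show "Sp \<noteq> 0" using R0 RS by auto
      assume "Sp < 0"
      then have "c \<le> ?E" using main[of "- 1"] RS by simp
      then have "\<rho> * c \<le> \<rho> * ?E" using \<rho> by (intro mult_left_mono) auto
      then show "\<Delta> * c \<le> \<rho> * ?E" using scale by linarith
    next
      assume "Sp > 0"
      then have "c \<le> - ?E" using main[of 1] RS by simp
      then have "\<rho> * c \<le> \<rho> * - ?E" using \<rho> by (intro mult_left_mono) auto
      then show "\<rho> * ?E \<le> - (\<Delta> * c)" using scale unfolding mult_minus_right by linarith
    qed
  qed (use \<delta>1 \<delta>2 c pos in auto)
qed

section \<open>Symmetry of the second derivative\<close>

text \<open>The mean value theorem is applied first along \<open>u\<close> to the increment of
  \<open>f\<close> in direction \<open>w\<close>, then along \<open>w\<close> to the first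
  derivative.\<close>

lemma second_difference:
  fixes f :: "'a::real_normed_vector \<Rightarrow> real"
    and f' :: "'a \<Rightarrow> 'a \<Rightarrow>\<^sub>L real" and f'' :: "'a \<Rightarrow> 'a \<Rightarrow>\<^sub>L ('a \<Rightarrow>\<^sub>L real)"
  assumes "0 < h" and U: "\<And>a b. 0 \<le> a \<Longrightarrow> a \<le> h \<Longrightarrow> 0 \<le> b \<Longrightarrow> b \<le> h \<Longrightarrow> x + a *\<^sub>R u + b *\<^sub>R w \<in> U"
    and d1: "\<And>y. y \<in> U \<Longrightarrow> (f has_derivative f' y) (at y)"
    and d2: "\<And>y. y \<in> U \<Longrightarrow> (f' has_derivative f'' y) (at y)"
  shows "\<exists>a b. 0 \<le> a \<and> a \<le> h \<and> 0 \<le> b \<and> b \<le> h \<and>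
    f (x + h *\<^sub>R u + h *\<^sub>R w) - f (x + h *\<^sub>R u) - f (x + h *\<^sub>R w) + f x
      = h\<^sup>2 * f'' (x + a *\<^sub>R u + b *\<^sub>R w) w u"
proof -
  let ?g = "\<lambda>a. f (x + a *\<^sub>R u + h *\<^sub>R w) - f (x + a *\<^sub>R u + 0 *\<^sub>R w)"
  have "\<exists>a>0. a < h \<and> ?g h - ?g 0 = (h - 0) * (f' (x + a *\<^sub>R u + h *\<^sub>R w) u - f' (x + a *\<^sub>R u + 0 *\<^sub>R w) u)"
  proof (rule MVT2[OF \<open>0 < h\<close>])
    fix a assume a: "0 \<le> a" "a \<le> h"
    have *: "((\<lambda>a. f (x + a *\<^sub>R u + b *\<^sub>R w)) has_real_derivative f' (x + a *\<^sub>R u + b *\<^sub>R w) u) (at a)"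
      if "0 \<le> b" "b \<le> h" for b
    proof -
      have "((\<lambda>a. x + a *\<^sub>R u + b *\<^sub>R w) has_derivative (\<lambda>s. s *\<^sub>R u)) (at a)"
        by (auto intro!: derivative_eq_intros)
      from has_derivative_compose[OF this d1[OF U[OF a that]]] show ?thesis
        by (simp add: has_field_derivative_def blinfun.scaleR_right mult.commute[of _ "blinfun_apply _ _"])
    qed
    show "(?g has_real_derivative f' (x + a *\<^sub>R u + h *\<^sub>R w) u - f' (x + a *\<^sub>R u + 0 *\<^sub>R w) u) (at a)"
      by (intro DERIV_diff *) (use \<open>0 < h\<close> in auto)
  qed
  then obtain a where a: "0 < a" "a < h"
    "?g h - ?g 0 = h * (f' (x + a *\<^sub>R u + h *\<^sub>R w) u - f' (x + a *\<^sub>R u + 0 *\<^sub>R w) u)" by auto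
  have "\<exists>b>0. b < h \<and> f' (x + a *\<^sub>R u + h *\<^sub>R w) u - f' (x + a *\<^sub>R u + 0 *\<^sub>R w) u
      = (h - 0) * f'' (x + a *\<^sub>R u + b *\<^sub>R w) w u"
  proof (rule MVT2[OF \<open>0 < h\<close>])
    fix b assume b: "0 \<le> b" "b \<le> h"
    have "((\<lambda>b. x + a *\<^sub>R u + b *\<^sub>R w) has_derivative (\<lambda>s. s *\<^sub>R w)) (at b)"
      by (auto intro!: derivative_eq_intros)
    from has_derivative_compose[OF this d2[OF U[OF _ _ b]]] a
    have "((\<lambda>b. f' (x + a *\<^sub>R u + b *\<^sub>R w)) has_derivative (\<lambda>s. f'' (x + a *\<^sub>R u + b *\<^sub>R w) (s *\<^sub>R w))) (at b)"
      by simp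
    from blinfun.FDERIV[OF this has_derivative_const[of u]]
    show "((\<lambda>b. f' (x + a *\<^sub>R u + b *\<^sub>R w) u) has_real_derivative f'' (x + a *\<^sub>R u + b *\<^sub>R w) w u) (at b)"
      by (simp add: has_field_derivative_def blinfun.bilinear_simps mult.commute[of _ "blinfun_apply _ _"])
  qed
  then obtain b where b: "0 < b" "b < h" "f' (x + a *\<^sub>R u + h *\<^sub>R w) u - f' (x + a *\<^sub>R u + 0 *\<^sub>R w) u
      = h * f'' (x + a *\<^sub>R u + b *\<^sub>R w) w u" by auto
  show ?thesis
    using a b by (intro exI[of _ a] exI[of _ b]) (simp add: power2_eq_square)
qed

text \<open>The second difference is unchanged when \<open>u\<close> and \<open>w\<close> are
  exchanged, so evaluating it in both orders on ever smaller parallelograms and using continuity of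
  \<open>f''\<close> forces equality. It is used in space-time, both for mixed time and space
  derivatives and for the Hessian.\<close>

lemma second_derivative_symmetric:
  fixes f :: "'a::real_normed_vector \<Rightarrow> real"
    and f' :: "'a \<Rightarrow> 'a \<Rightarrow>\<^sub>L real" and f'' :: "'a \<Rightarrow> 'a \<Rightarrow>\<^sub>L ('a \<Rightarrow>\<^sub>L real)"
  assumes "open U" "x \<in> U"
    and d1: "\<And>y. y \<in> U \<Longrightarrow> (f has_derivative f' y) (at y)"
    and d2: "\<And>y. y \<in> U \<Longrightarrow> (f' has_derivative f'' y) (at y)"
    and cont: "continuous_on U f''"
  shows "f'' x u w = f'' x w u"
proof (rule ccontr)
  assume ne: "f'' x u w \<noteq> f'' x w u"
  define e where "e = \<bar>f'' x u w - f'' x w u\<bar> / 2"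
  have e: "e > 0" using ne by (simp add: e_def)
  have isc: "(f'' \<longlongrightarrow> f'' x) (nhds x)"
    using cont assms(1,2) by (simp add: continuous_on_eq_continuous_at isCont_def tendsto_at_iff_tendsto_nhds)
  have "((\<lambda>y. f'' y u w) \<longlongrightarrow> f'' x u w) (nhds x)" "((\<lambda>y. f'' y w u) \<longlongrightarrow> f'' x w u) (nhds x)"
    by (intro blinfun.tendsto isc tendsto_const)+
  then have "\<forall>\<^sub>F y in nhds x. dist (f'' y u w) (f'' x u w) < e \<and> dist (f'' y w u) (f'' x w u) < e \<and> y \<in> U"
    using e assms(1,2) by (auto simp: tendsto_iff eventually_conj_iff eventually_nhds_in_open)
  then obtain d where d: "d > 0"
    "\<And>y. dist y x < d \<Longrightarrow> dist (f'' y u w) (f'' x u w) < e \<and> dist (f'' y w u) (f'' x w u) < e \<and> y \<in> U"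
    by (auto simp: eventually_nhds_metric)
  define k where "k = norm u + norm w + 1"
  \<comment> \<open>Every corner displacement is then at most h * k = d / 2, so the parallelogram
    lies in the ball of radius \<open>d\<close>; the 1 in \<open>k\<close> covers vanishing
    directions.\<close>
  define h where "h = d / k / 2"
  have pos: "k > 0" unfolding k_def by (smt (verit) norm_ge_zero)
  then have h: "h > 0" using d by (simp add: h_def)
  have near: "dist (x + a *\<^sub>R u + b *\<^sub>R w) x < d" if "0 \<le> a" "a \<le> h" "0 \<le> b" "b \<le> h" for a b
  proof -
    have "dist (x + a *\<^sub>R u + b *\<^sub>R w) x \<le> a * norm u + b * norm w"
      using norm_triangle_ineq[of "a *\<^sub>R u" "b *\<^sub>R w"] that by (simp add: dist_norm)
    also have "\<dots> \<le> h * norm u + h * norm w"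
      using that by (intro add_mono mult_right_mono) auto
    also have "\<dots> \<le> h * k" using h by (simp add: k_def algebra_simps)
    also have "h * k = d / 2" using pos by (simp add: h_def)
    also have "\<dots> < d" using d by simp
    finally show ?thesis .
  qed
  obtain a b where ab: "0 \<le> a" "a \<le> h" "0 \<le> b" "b \<le> h"
    "f (x + h *\<^sub>R u + h *\<^sub>R w) - f (x + h *\<^sub>R u) - f (x + h *\<^sub>R w) + f x = h\<^sup>2 * f'' (x + a *\<^sub>R u + b *\<^sub>R w) w u"
    using second_difference[OF h, of x u w U f f' f''] d near d1 d2 by blast
  have near': "dist (x + a *\<^sub>R w + b *\<^sub>R u) x < d" if "0 \<le> a" "a \<le> h" "0 \<le> b" "b \<le> h" for a b
    using near[of b a] that by (simp add: ac_simps)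
  obtain a' b' where ab': "0 \<le> a'" "a' \<le> h" "0 \<le> b'" "b' \<le> h"
    "f (x + h *\<^sub>R w + h *\<^sub>R u) - f (x + h *\<^sub>R w) - f (x + h *\<^sub>R u) + f x = h\<^sup>2 * f'' (x + a' *\<^sub>R w + b' *\<^sub>R u) u w"
    using second_difference[OF h, of x w u U f f' f''] d near' d1 d2 by blast
  have "h\<^sup>2 * f'' (x + a *\<^sub>R u + b *\<^sub>R w) w u = h\<^sup>2 * f'' (x + a' *\<^sub>R w + b' *\<^sub>R u) u w"
    using ab(5) ab'(5) unfolding add.assoc add.commute[of "h *\<^sub>R w" "h *\<^sub>R u"] by linarith
  then have "f'' (x + a *\<^sub>R u + b *\<^sub>R w) w u = f'' (x + a' *\<^sub>R w + b' *\<^sub>R u) u w" using h by simp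
  moreover have "dist (f'' (x + a *\<^sub>R u + b *\<^sub>R w) w u) (f'' x w u) < e"
    "dist (f'' (x + a' *\<^sub>R w + b' *\<^sub>R u) u w) (f'' x u w) < e"
    using d(2)[OF near[OF ab(1-4)]] d(2)[OF near'[OF ab'(1-4)]] by auto
  ultimately show False by (simp add: dist_real_def e_def abs_if split: if_splits)
qed

section \<open>Derivatives of the field along a trajectory\<close>

lemma gradient_eqI:
  fixes f :: "real^'n \<Rightarrow> real"
  assumes "(f has_derivative f') (at p)"
  shows "gradient f p = (\<chi> i. f' (axis i 1))"
proof -
  define g where "g = (\<chi> i. f' (axis i 1))"
  have lin: "linear f'" using assms by (rule has_derivative_linear)
  have f': "f' h = h \<bullet> g" for h
  proof -
    have "f' h = f' (\<Sum>i\<in>UNIV. h $ i *\<^sub>R axis i 1)"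
      using basis_expansion[of h] by (simp add: scalar_mult_eq_scaleR)
    also have "\<dots> = (\<Sum>i\<in>UNIV. h $ i * f' (axis i 1))"
      by (simp add: linear_sum[OF lin] linear_cmul[OF lin])
    finally show "f' h = h \<bullet> g" by (simp add: inner_vec_def g_def)
  qed
  have "(f has_derivative (\<lambda>h. h \<bullet> g)) (at p)"
    using assms by (rule has_derivative_eq_rhs) (auto simp: f')
  moreover have "g' = g" if "(f has_derivative (\<lambda>h. h \<bullet> g')) (at p)" for g'
    using has_derivative_unique[OF that calculation] vector_eq_ldot by metis
  ultimately show ?thesis
    unfolding gradient_def gderiv_def g_def[symmetric] by (intro the_equality)
qed

lemma time_deriv_eqI:
  assumes "0 < t" "(g has_vector_derivative g') (at t)"
  shows "time_deriv g t = g'"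
proof -
  have "at t within {0..} = at t"
    by (rule at_within_open_subset[of t "{0<..}"]) (use assms(1) in auto)
  then show ?thesis
    unfolding time_deriv_def by (simp add: vector_derivative_at[OF assms(2)])
qed

lemma axis_comb: "(vector [a, b] :: real^2) = a *\<^sub>R axis 1 1 + b *\<^sub>R axis 2 1"
  by (simp add: vec_eq_iff forall_2 axis_def vector_2)

text \<open>All iterated partial derivatives are identified with entries of the first two
  derivatives of the joint map on space-time; the chain rule then does the rest. The continuity
  claims make the turning rate continuous, as its integration in \<open>angle_lift\<close>
  requires.\<close>

lemma field_along_trajectory:
  fixes D :: field2
  assumes C2: "C2_on ({0..} \<times> UNIV) (\<lambda>(t, p). D t p)"
    and r: "\<And>t. 0 < t \<Longrightarrow> (r has_vector_derivative v *\<^sub>R evec (\<theta> t)) (at t)"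
    and t: "0 < t"
  shows "((\<lambda>t. D t (r t)) has_real_derivative
      Dt D t (r t) + v * (cos (\<theta> t) * gradient (D t) (r t) $ 1 + sin (\<theta> t) * gradient (D t) (r t) $ 2)) (at t)"
    and "((\<lambda>t. Dt D t (r t)) has_real_derivative
      Dtt D t (r t) + v * (cos (\<theta> t) * grad_Dt D t (r t) $ 1 + sin (\<theta> t) * grad_Dt D t (r t) $ 2)) (at t)"
    and "\<And>i. ((\<lambda>t. gradient (D t) (r t) $ i) has_real_derivative
      grad_Dt D t (r t) $ i + v * (cos (\<theta> t) * hessian (D t) (r t) $ i $ 1 + sin (\<theta> t) * hessian (D t) (r t) $ i $ 2)) (at t)"
    and "hessian (D t) (r t) $ 2 $ 1 = hessian (D t) (r t) $ 1 $ 2"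
    and "\<And>i. isCont (\<lambda>t. grad_Dt D t (r t) $ i) t"
    and "\<And>i j. isCont (\<lambda>t. hessian (D t) (r t) $ i $ j) t"
proof -
  define U where "U = {0::real<..} \<times> (UNIV :: (real^2) set)"
  have U: "open U" unfolding U_def by (intro open_Times) auto
  have mem: "(s, p) \<in> U \<longleftrightarrow> 0 < s" for s p by (simp add: U_def)
  have within: "at y within {0..} \<times> UNIV = at y" if "y \<in> U" for y :: "real \<times> (real^2)"
  proof (rule at_within_interior)
    have "U \<subseteq> interior ({0..} \<times> UNIV)" using U by (intro interior_maximal) (auto simp: U_def)
    then show "y \<in> interior ({0..} \<times> UNIV)" using that by blast
  qed
  define F where "F = (\<lambda>(t, p). D t p)"
  have F[simp]: "F (s, p) = D s p" for s p by (simp add: F_def)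
  obtain f' f'' where f': "\<And>y. y \<in> {0..} \<times> UNIV \<Longrightarrow> (F has_derivative blinfun_apply (f' y)) (at y within {0..} \<times> UNIV)"
    and f'': "\<And>y. y \<in> {0..} \<times> UNIV \<Longrightarrow> (f' has_derivative blinfun_apply (f'' y)) (at y within {0..} \<times> UNIV)"
    and cont: "continuous_on ({0..} \<times> UNIV) f''"
    using C2 unfolding C2_on_def C1_on_def F_def by blast
  have sub: "U \<subseteq> {0..} \<times> UNIV" by (auto simp: U_def)
  have d1: "(F has_derivative blinfun_apply (f' y)) (at y)" if "y \<in> U" for y
    using f'[of y] within[OF that] that sub by auto
  have d2: "(f' has_derivative blinfun_apply (f'' y)) (at y)" if "y \<in> U" for y
    using f''[of y] within[OF that] that sub by auto
  have cU: "continuous_on U f''" using cont sub continuous_on_subset by blast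
  have sym: "f'' y u w = f'' y w u" if "y \<in> U" for y u w
    using second_derivative_symmetric[OF U that d1 d2 cU] .
  have emb: "((\<lambda>q. (s, q)) has_derivative (\<lambda>h. (0, h))) (at p)" for s :: real and p :: "real^2"
    by (auto intro!: derivative_eq_intros)
  have embt: "((\<lambda>s. (s, p)) has_derivative (\<lambda>h. (h, 0))) (at s)" for s :: real and p :: "real^2"
    by (auto intro!: derivative_eq_intros)
  have grad: "gradient (D s) p = (\<chi> i. f' (s, p) (0, axis i 1))" if s: "0 < s" for s p
    using gradient_eqI[OF has_derivative_compose[OF emb d1[of "(s, p)"]]] s mem by simp
  have DtE: "Dt D s p = f' (s, p) (1, 0)" if s: "0 < s" for s p
    unfolding Dt_def
  proof (rule time_deriv_eqI[OF s])
    have "(\<lambda>h. f' (s, p) (h, 0)) = (\<lambda>h. h *\<^sub>R f' (s, p) (1, 0))"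
      unfolding blinfun.scaleR_right[symmetric] by simp
    moreover have "((\<lambda>s. D s p) has_derivative (\<lambda>h. f' (s, p) (h, 0))) (at s)"
      using has_derivative_compose[OF embt d1[of "(s, p)"]] s mem by simp
    ultimately show "((\<lambda>s. D s p) has_vector_derivative f' (s, p) (1, 0)) (at s)"
      unfolding has_vector_derivative_def by metis
  qed
  have apply_deriv: "((\<lambda>y. f' y w) has_derivative (\<lambda>h. f'' y h w)) (at y)" if "y \<in> U" for y w
    using blinfun.FDERIV[OF d2[OF that] has_derivative_const[of w]] by simp
  have grad_DtE: "grad_Dt D s p = (\<chi> i. f'' (s, p) (0, axis i 1) (1, 0))" if s: "0 < s" for s p
  proof -
    have "Dt D s = (\<lambda>p. f' (s, p) (1, 0))" using DtE[OF s] by auto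
    then show ?thesis
      using gradient_eqI[OF has_derivative_compose[OF emb apply_deriv[of "(s, p)" "(1, 0)"]]] s mem
      by (simp add: grad_Dt_def)
  qed
  have DttE: "Dtt D s p = f'' (s, p) (1, 0) (1, 0)" if s: "0 < s" for s p
    unfolding Dtt_def
  proof (rule time_deriv_eqI[OF s])
    have *: "f'' (s, p) (h, 0) = h *\<^sub>R f'' (s, p) (1, 0)" for h
      using blinfun.scaleR_right[of "f'' (s, p)" h "(1, 0)"] by simp
    have "(\<lambda>h. f'' (s, p) (h, 0) (1, 0)) = (\<lambda>h. h *\<^sub>R f'' (s, p) (1, 0) (1, 0))"
      by (rule ext, subst *, rule blinfun.scaleR_left)
    moreover have "((\<lambda>s. f' (s, p) (1, 0)) has_derivative (\<lambda>h. f'' (s, p) (h, 0) (1, 0))) (at s)"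
      using has_derivative_compose[OF embt apply_deriv[of "(s, p)" "(1, 0)"]] s mem by simp
    ultimately have "((\<lambda>s. f' (s, p) (1, 0)) has_vector_derivative f'' (s, p) (1, 0) (1, 0)) (at s)"
      unfolding has_vector_derivative_def by metis
    then show "((\<lambda>s. Dt D s p) has_vector_derivative f'' (s, p) (1, 0) (1, 0)) (at s)"
      by (rule has_vector_derivative_transform_within_open[of _ _ _ "{0<..}"]) (use s DtE in auto)
  qed
  have hessE: "hessian (D s) p $ i $ j = f'' (s, p) (0, axis j 1) (0, axis i 1)" if s: "0 < s" for s p i j
  proof -
    have "(gradient (D s) has_derivative (\<lambda>h. \<chi> i. f'' (s, p) (0, h) (0, axis i 1))) (at p)"
    proof (subst has_derivative_componentwise_within, intro ballI)
      fix b :: "real^2" assume "b \<in> Basis"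
      then obtain i where b: "b = axis i 1" by (auto simp: Basis_vec_def)
      have "(\<lambda>q. gradient (D s) q \<bullet> b) = (\<lambda>q. f' (s, q) (0, axis i 1))"
        using grad[OF s] by (simp add: b inner_axis)
      then show "((\<lambda>q. gradient (D s) q \<bullet> b) has_derivative
          (\<lambda>h. (\<chi> i. f'' (s, p) (0, h) (0, axis i 1)) \<bullet> b)) (at p)"
        using has_derivative_compose[OF emb apply_deriv[of "(s, p)" "(0, axis i 1)"]] s mem
        by (simp add: b inner_axis)
    qed
    then have "frechet_derivative (gradient (D s)) (at p) = (\<lambda>h. \<chi> i. f'' (s, p) (0, h) (0, axis i 1))"
      by (rule frechet_derivative_at[symmetric])
    then show ?thesis by (simp add: hessian_def jacobian_def matrix_def)
  qed
  let ?e = "evec (\<theta> t)"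
  have e: "?e = cos (\<theta> t) *\<^sub>R axis 1 1 + sin (\<theta> t) *\<^sub>R axis 2 1"
    unfolding evec_def by (rule axis_comb)
  have dir: "(1::real, v *\<^sub>R ?e) = (1, 0) + v *\<^sub>R (cos (\<theta> t) *\<^sub>R (0, axis 1 1) + sin (\<theta> t) *\<^sub>R (0, axis 2 1))"
    by (simp add: e)
  have xU: "(t, r t) \<in> U" using t mem by simp
  have x: "((\<lambda>t. (t, r t)) has_derivative (\<lambda>h. h *\<^sub>R (1, v *\<^sub>R ?e))) (at t)"
    using r[OF t] unfolding has_vector_derivative_def by (auto intro!: derivative_eq_intros)
  have chain: "((\<lambda>t. \<phi> (t, r t)) has_real_derivative \<phi>' (1, v *\<^sub>R ?e)) (at t)"
    if "(\<phi> has_derivative \<phi>') (at (t, r t))" for \<phi> :: "real \<times> (real^2) \<Rightarrow> real" and \<phi>'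
  proof -
    have "linear \<phi>'" using that by (rule has_derivative_linear)
    then show ?thesis using has_derivative_compose[OF x that]
      by (simp add: has_field_derivative_def linear_cmul mult.commute[of _ "\<phi>' _"] del: scaleR_Pair)
  qed
  show "((\<lambda>t. D t (r t)) has_real_derivative
      Dt D t (r t) + v * (cos (\<theta> t) * gradient (D t) (r t) $ 1 + sin (\<theta> t) * gradient (D t) (r t) $ 2)) (at t)"
    using chain[OF d1[OF xU]] unfolding dir
    by (simp add: DtE[OF t] grad[OF t] blinfun.bilinear_simps del: scaleR_Pair add_Pair)
  show "((\<lambda>t. Dt D t (r t)) has_real_derivative
      Dtt D t (r t) + v * (cos (\<theta> t) * grad_Dt D t (r t) $ 1 + sin (\<theta> t) * grad_Dt D t (r t) $ 2)) (at t)"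
  proof (rule has_field_derivative_transform_within_open[of "\<lambda>t. f' (t, r t) (1, 0)" _ _ "{0<..}"])
    show "((\<lambda>t. f' (t, r t) (1, 0)) has_real_derivative
      Dtt D t (r t) + v * (cos (\<theta> t) * grad_Dt D t (r t) $ 1 + sin (\<theta> t) * grad_Dt D t (r t) $ 2)) (at t)"
      using chain[OF apply_deriv[OF xU, of "(1, 0)"]] unfolding dir
      by (simp add: DttE[OF t] grad_DtE[OF t] blinfun.bilinear_simps del: scaleR_Pair add_Pair)
  qed (use t DtE in auto)
  \<comment> \<open>The chain rule produces \<open>f''\<close> with the time direction in the first
    slot, whereas \<open>grad_Dt\<close> has it in the second; symmetry exchanges them.\<close>
  show "((\<lambda>t. gradient (D t) (r t) $ i) has_real_derivative
      grad_Dt D t (r t) $ i + v * (cos (\<theta> t) * hessian (D t) (r t) $ i $ 1 + sin (\<theta> t) * hessian (D t) (r t) $ i $ 2)) (at t)" for i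
  proof (rule has_field_derivative_transform_within_open[of "\<lambda>t. f' (t, r t) (0, axis i 1)" _ _ "{0<..}"])
    show "((\<lambda>t. f' (t, r t) (0, axis i 1)) has_real_derivative
      grad_Dt D t (r t) $ i + v * (cos (\<theta> t) * hessian (D t) (r t) $ i $ 1 + sin (\<theta> t) * hessian (D t) (r t) $ i $ 2)) (at t)"
      using chain[OF apply_deriv[OF xU, of "(0, axis i 1)"]] sym[OF xU, of "(1, 0)"] unfolding dir
      by (simp add: hessE[OF t] grad_DtE[OF t] blinfun.bilinear_simps del: scaleR_Pair add_Pair)
  qed (use t grad in auto)
  show "hessian (D t) (r t) $ 2 $ 1 = hessian (D t) (r t) $ 1 $ 2"
    by (simp add: hessE[OF t] sym[OF xU])
  have "isCont (\<lambda>t. (t, r t)) t" using has_derivative_continuous[OF x] .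
  then have xlim: "((\<lambda>t. (t, r t)) \<longlongrightarrow> (t, r t)) (at t)" by (simp add: isCont_def)
  have "isCont f'' (t, r t)" using cU U xU by (simp add: continuous_on_eq_continuous_at)
  from isCont_tendsto_compose[OF this xlim]
  have lim: "((\<lambda>t. f'' (t, r t)) \<longlongrightarrow> f'' (t, r t)) (at t)" .
  have ev: "\<forall>\<^sub>F s in at t. 0 < s" using order_tendstoD(1)[OF tendsto_ident_at t] .
  show "isCont (\<lambda>t. grad_Dt D t (r t) $ i) t" for i
    unfolding isCont_def grad_DtE[OF t]
    by (rule Lim_transform_eventually[where f = "\<lambda>t. f'' (t, r t) (0, axis i 1) (1, 0)"])
      (use ev in \<open>auto intro!: blinfun.tendsto lim tendsto_const elim!: eventually_mono simp: grad_DtE\<close>)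
  show "isCont (\<lambda>t. hessian (D t) (r t) $ i $ j) t" for i j
    unfolding isCont_def hessE[OF t]
    by (rule Lim_transform_eventually[where f = "\<lambda>t. f'' (t, r t) (0, axis j 1) (0, axis i 1)"])
      (use ev in \<open>auto intro!: blinfun.tendsto lim tendsto_const elim!: eventually_mono simp: hessE\<close>)
qed

section \<open>The moving frame of the isoline\<close>

text \<open>\<open>W\<close> is the rate of the polar angle of the gradient minus the rate of the
  heading; \<open>C\<close> and \<open>S\<close> are the cosine and sine of the difference of these
  angles. The change of the length of the gradient cancels.\<close>

lemma frame_deriv:
  fixes g1 g2 \<theta> :: "real \<Rightarrow> real"
  assumes g1: "(g1 has_real_derivative g1') (at t)" and g2: "(g2 has_real_derivative g2') (at t)"
    and \<theta>: "(\<theta> has_real_derivative \<theta>') (at t)" and ne: "0 < (g1 t)\<^sup>2 + (g2 t)\<^sup>2"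
  defines "\<rho> \<equiv> \<lambda>t. sqrt ((g1 t)\<^sup>2 + (g2 t)\<^sup>2)"
  defines "C \<equiv> \<lambda>t. (cos (\<theta> t) * g1 t + sin (\<theta> t) * g2 t) / \<rho> t"
    and "S \<equiv> \<lambda>t. (cos (\<theta> t) * g2 t - sin (\<theta> t) * g1 t) / \<rho> t"
    and "W \<equiv> (g1 t * g2' - g2 t * g1') / (\<rho> t)\<^sup>2 - \<theta>'"
  shows "(C has_real_derivative - (W * S t)) (at t)" "(S has_real_derivative W * C t) (at t)"
proof -
  have \<rho>0: "0 < \<rho> t" and \<rho>2: "(\<rho> t)\<^sup>2 = (g1 t)\<^sup>2 + (g2 t)\<^sup>2" using ne by (simp_all add: \<rho>_def)
  have d\<rho>: "(\<rho> has_real_derivative (g1 t * g1' + g2 t * g2') / \<rho> t) (at t)"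
  proof -
    have "((\<lambda>t. (g1 t)\<^sup>2 + (g2 t)\<^sup>2) has_real_derivative 2 * (g1 t * g1' + g2 t * g2')) (at t)"
      by (auto intro!: derivative_eq_intros g1 g2)
    from DERIV_chain2[OF DERIV_real_sqrt[OF ne] this]
    have "(\<rho> has_real_derivative inverse (\<rho> t) / 2 * (2 * (g1 t * g1' + g2 t * g2'))) (at t)"
      unfolding \<rho>_def .
    moreover have "inverse x / 2 * (2 * y) = y / x" for x y :: real
      by (cases "x = 0") (simp_all add: field_simps)
    ultimately show ?thesis by metis
  qed
  let ?c = "cos (\<theta> t)" and ?s = "sin (\<theta> t)"
  have "((\<lambda>t. cos (\<theta> t) * g1 t + sin (\<theta> t) * g2 t) has_real_derivative
      (?c * g1' - ?s * \<theta>' * g1 t + (?s * g2' + ?c * \<theta>' * g2 t))) (at t)"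
    by (auto intro!: derivative_eq_intros g1 g2 \<theta> simp: algebra_simps)
  from DERIV_divide[OF this d\<rho>] \<rho>0
  have "(C has_real_derivative
      ((?c * g1' - ?s * \<theta>' * g1 t + (?s * g2' + ?c * \<theta>' * g2 t)) * \<rho> t
        - (?c * g1 t + ?s * g2 t) * ((g1 t * g1' + g2 t * g2') / \<rho> t)) / (\<rho> t * \<rho> t)) (at t)"
    unfolding C_def by simp
  moreover have "((?c * g1' - ?s * \<theta>' * g1 t + (?s * g2' + ?c * \<theta>' * g2 t)) * \<rho> t
        - (?c * g1 t + ?s * g2 t) * ((g1 t * g1' + g2 t * g2') / \<rho> t)) / (\<rho> t * \<rho> t) = - (W * S t)"
  proof -
    \<comment> \<open>Multiplication by the cube of \<rho> removes all denominators and leaves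
      \<rho> only squared, so that it can be expressed by the components of the gradient.\<close>
    have "((?c * g1' - ?s * \<theta>' * g1 t + (?s * g2' + ?c * \<theta>' * g2 t)) * \<rho> t
        - (?c * g1 t + ?s * g2 t) * ((g1 t * g1' + g2 t * g2') / \<rho> t)) / (\<rho> t * \<rho> t) * (\<rho> t)^3
      = (?c * g1' - ?s * \<theta>' * g1 t + (?s * g2' + ?c * \<theta>' * g2 t)) * (\<rho> t)\<^sup>2
        - (?c * g1 t + ?s * g2 t) * (g1 t * g1' + g2 t * g2')"
      using \<rho>0 by (simp add: field_simps power2_eq_square power3_eq_cube)
    also have "\<dots> = - ((g1 t * g2' - g2 t * g1') - \<theta>' * (\<rho> t)\<^sup>2) * (?c * g2 t - ?s * g1 t)"
      unfolding \<rho>2 by (simp add: algebra_simps power2_eq_square)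
    also have "\<dots> = - (W * S t) * (\<rho> t)^3"
      using \<rho>0 by (simp add: W_def S_def field_simps power2_eq_square power3_eq_cube)
    finally show ?thesis by (rule mult_right_cancel[THEN iffD1, rotated]) (use \<rho>0 in simp)
  qed
  ultimately show "(C has_real_derivative - (W * S t)) (at t)" by simp
  have "((\<lambda>t. cos (\<theta> t) * g2 t - sin (\<theta> t) * g1 t) has_real_derivative
      (?c * g2' - ?s * \<theta>' * g2 t - (?s * g1' + ?c * \<theta>' * g1 t))) (at t)"
    by (auto intro!: derivative_eq_intros g1 g2 \<theta> simp: algebra_simps)
  from DERIV_divide[OF this d\<rho>] \<rho>0
  have "(S has_real_derivative
      ((?c * g2' - ?s * \<theta>' * g2 t - (?s * g1' + ?c * \<theta>' * g1 t)) * \<rho> t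
        - (?c * g2 t - ?s * g1 t) * ((g1 t * g1' + g2 t * g2') / \<rho> t)) / (\<rho> t * \<rho> t)) (at t)"
    unfolding S_def by simp
  moreover have "((?c * g2' - ?s * \<theta>' * g2 t - (?s * g1' + ?c * \<theta>' * g1 t)) * \<rho> t
        - (?c * g2 t - ?s * g1 t) * ((g1 t * g1' + g2 t * g2') / \<rho> t)) / (\<rho> t * \<rho> t) = W * C t"
  proof -
    have "((?c * g2' - ?s * \<theta>' * g2 t - (?s * g1' + ?c * \<theta>' * g1 t)) * \<rho> t
        - (?c * g2 t - ?s * g1 t) * ((g1 t * g1' + g2 t * g2') / \<rho> t)) / (\<rho> t * \<rho> t) * (\<rho> t)^3
      = (?c * g2' - ?s * \<theta>' * g2 t - (?s * g1' + ?c * \<theta>' * g1 t)) * (\<rho> t)\<^sup>2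
        - (?c * g2 t - ?s * g1 t) * (g1 t * g1' + g2 t * g2')"
      using \<rho>0 by (simp add: field_simps power2_eq_square power3_eq_cube)
    also have "\<dots> = ((g1 t * g2' - g2 t * g1') - \<theta>' * (\<rho> t)\<^sup>2) * (?c * g1 t + ?s * g2 t)"
      unfolding \<rho>2 by (simp add: algebra_simps power2_eq_square)
    also have "\<dots> = (W * C t) * (\<rho> t)^3"
      using \<rho>0 by (simp add: W_def C_def field_simps power2_eq_square power3_eq_cube)
    finally show ?thesis by (rule mult_right_cancel[THEN iffD1, rotated]) (use \<rho>0 in simp)
  qed
  ultimately show "(S has_real_derivative W * C t) (at t)" by simp
qed

lemma norm_real2: "norm (g :: real^2) = sqrt ((g $ 1)\<^sup>2 + (g $ 2)\<^sup>2)"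
  by (simp add: norm_eq_sqrt_inner inner_vec_def sum_2 power2_eq_square)

lemma mult_vec2: "(A *v x :: real^2) $ i = A $ i $ 1 * x $ 1 + A $ i $ 2 * (x :: real^2) $ 2"
  by (simp add: matrix_vector_mult_def sum_2)

lemma inner2: "(x :: real^2) \<bullet> y = x $ 1 * y $ 1 + x $ 2 * y $ 2"
  by (simp add: inner_vec_def sum_2)

text \<open>Here \<open>s\<close> is the rate of d. The last identity is its derivative under the
  control law, in the form bounded by \<open>strip_estimate\<close>.\<close>

lemma frame_identities:
  fixes D :: field2 and t :: real and p :: "real^2" and e1 e2 v :: real
  defines "g1 \<equiv> gradient (D t) p $ 1" and "g2 \<equiv> gradient (D t) p $ 2"
    and "b1 \<equiv> grad_Dt D t p $ 1" and "b2 \<equiv> grad_Dt D t p $ 2"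
    and "H11 \<equiv> hessian (D t) p $ 1 $ 1" and "H12 \<equiv> hessian (D t) p $ 1 $ 2"
    and "H22 \<equiv> hessian (D t) p $ 2 $ 2"
  assumes sym: "hessian (D t) p $ 2 $ 1 = H12" and e: "e1\<^sup>2 + e2\<^sup>2 = 1" and pos: "0 < rho D t p"
  defines "C \<equiv> (e1 * g1 + e2 * g2) / rho D t p" and "S \<equiv> (e1 * g2 - e2 * g1) / rho D t p"
    and "gd1 \<equiv> b1 + v * (e1 * H11 + e2 * H12)" and "gd2 \<equiv> b2 + v * (e1 * H12 + e2 * H22)"
  defines "s \<equiv> rho D t p * (v * C - front_vel D t p)"
  shows "C\<^sup>2 + S\<^sup>2 = 1"
    and "Dt D t p + v * (e1 * g1 + e2 * g2) = s"
    and "omega_grad D t p = omega D t p + front_vel D t p * tau_rho D t p"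
    and "(g1 * gd2 - g2 * gd1) / (rho D t p)\<^sup>2
      = omega_grad D t p + kappa D t p * (v * S) - tau_rho D t p * (v * C)"
    and "Dtt D t p + v * (e1 * b1 + e2 * b2) + v * (e1 * gd1 + e2 * gd2 + (e1 * g2 - e2 * g1) * (\<mu> * (s - \<nu>)))
      = rho D t p * (- front_acc D t p + 2 * v_rho D t p * (s / rho D t p) + n_rho D t p * (s / rho D t p)\<^sup>2
          + v * S * (- 2 * omega D t p + 2 * tau_rho D t p * (s / rho D t p) - kappa D t p * (v * S) - \<mu> * (\<nu> - s)))"
proof -
  define \<rho> where "\<rho> = rho D t p"
  have \<rho>0: "0 < \<rho>" using pos by (simp add: \<rho>_def)
  have rho: "norm (gradient (D t) p) = \<rho>" by (simp add: \<rho>_def rho_def)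
  define N1 where "N1 = g1 / \<rho>"
  define N2 where "N2 = g2 / \<rho>"
  have g: "g1 = \<rho> * N1" "g2 = \<rho> * N2" using \<rho>0 by (simp_all add: N1_def N2_def)
  have "\<rho>\<^sup>2 = g1\<^sup>2 + g2\<^sup>2" using rho by (simp add: norm_real2 g1_def g2_def real_sqrt_eq_iff flip: rho)
  moreover have "N1\<^sup>2 + N2\<^sup>2 = (g1\<^sup>2 + g2\<^sup>2) / \<rho>\<^sup>2"
    by (simp add: N1_def N2_def power_divide add_divide_distrib)
  ultimately have "N1\<^sup>2 + N2\<^sup>2 = \<rho>\<^sup>2 / \<rho>\<^sup>2" by metis
  then have N: "N1\<^sup>2 + N2\<^sup>2 = 1" using \<rho>0 by simp
  have Nv: "normalN D t p $ 1 = N1" "normalN D t p $ 2 = N2"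
    by (simp_all add: normalN_def rho N1_def N2_def g1_def g2_def field_simps)
  have Tv: "tangentT D t p $ 1 = N2" "tangentT D t p $ 2 = - N1"
    by (simp_all add: tangentT_def rotate_cw_def vector_2 Nv)
  have C: "C = e1 * N1 + e2 * N2" and S: "S = e1 * N2 - e2 * N1"
    using \<rho>0 by (simp_all add: C_def S_def N1_def N2_def add_divide_distrib diff_divide_distrib flip: \<rho>_def)
  \<comment> \<open>Inverting the rotation writes the heading as C N + S T, after which all
    quantities can be compared in the frame.\<close>
  have "C * N1 + S * N2 = e1 * (N1\<^sup>2 + N2\<^sup>2)" "C * N2 - S * N1 = e2 * (N1\<^sup>2 + N2\<^sup>2)"
    by (simp_all add: C S power2_eq_square algebra_simps)
  then have e12: "e1 = C * N1 + S * N2" "e2 = C * N2 - S * N1" by (simp_all add: N)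
  have "C\<^sup>2 + S\<^sup>2 = (e1\<^sup>2 + e2\<^sup>2) * (N1\<^sup>2 + N2\<^sup>2)"
    unfolding C S by (simp add: power2_eq_square algebra_simps)
  then show "C\<^sup>2 + S\<^sup>2 = 1" by (simp add: N e)
  define l where "l = front_vel D t p"
  have Dt: "Dt D t p = - l * \<rho>" using \<rho>0 by (simp add: l_def front_vel_def rho)
  \<comment> \<open>The components, with respect to N and T, of the gradient of the time derivative
    and of the Hessian.\<close>
  define BN where "BN = b1 * N1 + b2 * N2"
  define BT where "BT = b1 * N2 - b2 * N1"
  define HNN where "HNN = H11 * N1\<^sup>2 + 2 * H12 * N1 * N2 + H22 * N2\<^sup>2"
  define HNT where "HNT = (H11 * N1 + H12 * N2) * N2 - (H12 * N1 + H22 * N2) * N1"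
  define HTT where "HTT = H11 * N2\<^sup>2 - 2 * H12 * N1 * N2 + H22 * N1\<^sup>2"
  note defs = inner2 mult_vec2 Nv Tv rho sym b1_def[symmetric] b2_def[symmetric] H11_def[symmetric]
    H12_def[symmetric] H22_def[symmetric] l_def[symmetric]
  have om_g: "omega_grad D t p = - BT / \<rho>"
    by (simp add: omega_grad_def defs BT_def algebra_simps)
  have ka: "kappa D t p = - HTT / \<rho>"
    by (simp add: kappa_def defs HTT_def power2_eq_square algebra_simps)
  have ta: "tau_rho D t p = HNT / \<rho>"
    by (simp add: tau_rho_def defs HNT_def power2_eq_square algebra_simps)
  have n: "n_rho D t p = HNN / \<rho>"
    by (simp add: n_rho_def defs HNN_def power2_eq_square algebra_simps)
  have vr: "v_rho D t p = (BN + l * HNN) / \<rho>"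
    by (simp add: v_rho_def defs HNN_def BN_def power2_eq_square algebra_simps)
  have om: "omega D t p = - (BT + l * HNT) / \<rho>"
    by (simp add: omega_def defs HNT_def BT_def power2_eq_square algebra_simps)
  have al: "front_acc D t p = - ((Dtt D t p + l * BN) / \<rho>) - l * ((BN + l * HNN) / \<rho>)"
    by (simp add: front_acc_def defs vr BN_def)
  show "omega_grad D t p = omega D t p + front_vel D t p * tau_rho D t p"
    unfolding om_g om ta l_def[symmetric] using \<rho>0 by (simp add: field_simps)
  have s: "s = \<rho> * (v * C - l)" by (simp add: s_def \<rho>_def l_def)
  have eg: "e1 * g1 + e2 * g2 = \<rho> * C" unfolding g C by (simp add: algebra_simps)
  show "Dt D t p + v * (e1 * g1 + e2 * g2) = s"
    unfolding eg Dt s by (simp add: algebra_simps)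
  have "g1 * gd2 - g2 * gd1 = \<rho> * (v * C * (- HNT) - v * S * HTT - BT)"
    unfolding gd1_def gd2_def g e12 HNT_def HTT_def BT_def
    by (simp add: power2_eq_square algebra_simps)
  then show "(g1 * gd2 - g2 * gd1) / (rho D t p)\<^sup>2
      = omega_grad D t p + kappa D t p * (v * S) - tau_rho D t p * (v * C)"
    unfolding om_g ka ta \<rho>_def[symmetric] using \<rho>0 by (simp add: field_simps power2_eq_square)
  have eb: "e1 * b1 + e2 * b2 = C * BN + S * BT"
    unfolding e12 BN_def BT_def by (simp add: algebra_simps)
  have egd: "e1 * gd1 + e2 * gd2 = C * BN + S * BT + v * (C\<^sup>2 * HNN + 2 * C * S * HNT + S\<^sup>2 * HTT)"
    unfolding gd1_def gd2_def e12 BN_def BT_def HNN_def HNT_def HTT_def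
    by (simp add: power2_eq_square algebra_simps)
  have es: "e1 * g2 - e2 * g1 = \<rho> * S" unfolding g S by (simp add: algebra_simps)
  have s\<rho>: "s / \<rho> = v * C - l" using \<rho>0 by (simp add: s)
  show "Dtt D t p + v * (e1 * b1 + e2 * b2) + v * (e1 * gd1 + e2 * gd2 + (e1 * g2 - e2 * g1) * (\<mu> * (s - \<nu>)))
      = rho D t p * (- front_acc D t p + 2 * v_rho D t p * (s / rho D t p) + n_rho D t p * (s / rho D t p)\<^sup>2
          + v * S * (- 2 * omega D t p + 2 * tau_rho D t p * (s / rho D t p) - kappa D t p * (v * S) - \<mu> * (\<nu> - s)))"
    unfolding eb egd es \<rho>_def[symmetric] s\<rho> om ka ta n vr al
    using \<rho>0 by (simp add: field_simps power2_eq_square)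
qed

section \<open>What condition (d) provides\<close>

text \<open>Let X = \<mu> (\<nu> - \<Gamma>), let Q bound the uncontrolled turning and let M be the
  bracketed numerator in \<open>a2\<close>. Then X > \<open>a1\<close> gives \<Omega> = X - Q > X (k
  + 2) / (2 (k + 1)), and X > \<open>a2\<close> gives \<open>b\<rho>\<close> M < X \<Delta>\<gamma>
  / 2. It remains to compare M with the cost V of one turn.\<close>

lemma turning_rate_margin:
  assumes nn: "0 \<le> b\<omega>" "0 < v" "0 \<le> b\<rho>" "0 \<le> b_lam" "0 \<le> \<Gamma>" "\<Gamma> < \<nu>" "0 < \<Delta>" "0 < \<Delta>\<gamma>"
    and \<mu>: "\<mu> > 1 / (\<nu> - \<Gamma>) * min_a v b\<rho> b_lam b\<omega> b\<kappa> b\<tau> \<Gamma> \<Delta> \<Delta>\<gamma>"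
  defines "\<Omega> \<equiv> \<mu> * (\<nu> - \<Gamma>) - (b\<omega> + v * sqrt (b\<kappa>\<^sup>2 + b\<tau>\<^sup>2))"
  shows "0 < \<Omega>" "b\<rho> * (9/4 * v + 2 * pi * (b_lam + \<Gamma> / \<Delta>)) / \<Omega> < \<Delta>\<gamma> / 2"
proof -
  define X where "X = \<mu> * (\<nu> - \<Gamma>)"
  define R where "R = v * sqrt (b\<kappa>\<^sup>2 + b\<tau>\<^sup>2)"
  define Y where "Y = b_lam + \<Gamma> / \<Delta>"
  have R: "0 \<le> R" and Y: "0 \<le> Y" using nn by (simp_all add: R_def Y_def)
  have a1: "a1 v b\<omega> b\<kappa> b\<tau> k = 2 * b\<omega> * (1 + 1 / real k) + 2 * R * (2 + 1 / real k)" for k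
    by (simp add: a1_def R_def)
  have a2: "a2 v b\<rho> b_lam \<Gamma> \<Delta> \<Delta>\<gamma> k = 2 * b\<rho> * (((2 * real k + 1) * v + 2 * pi * (real k + 1) * Y) / \<Delta>\<gamma>)" for k
    by (simp add: a2_def Y_def divide_inverse mult.commute)
  have "min_a v b\<rho> b_lam b\<omega> b\<kappa> b\<tau> \<Gamma> \<Delta> \<Delta>\<gamma> < X"
    using \<mu> nn(6) by (simp add: X_def pos_divide_less_eq)
  moreover have "bdd_below ((\<lambda>k. max (a1 v b\<omega> b\<kappa> b\<tau> k) (a2 v b\<rho> b_lam \<Gamma> \<Delta> \<Delta>\<gamma> k)) ` {1..})"
  proof (rule bdd_belowI2[of _ 0])
    fix k :: nat
    have "0 \<le> a1 v b\<omega> b\<kappa> b\<tau> k" unfolding a1 using nn R by simp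
    then show "0 \<le> max (a1 v b\<omega> b\<kappa> b\<tau> k) (a2 v b\<rho> b_lam \<Gamma> \<Delta> \<Delta>\<gamma> k)" by simp
  qed
  ultimately obtain k :: nat where k: "1 \<le> k"
    and ka: "a1 v b\<omega> b\<kappa> b\<tau> k < X" "a2 v b\<rho> b_lam \<Gamma> \<Delta> \<Delta>\<gamma> k < X"
    unfolding min_a_def by (subst (asm) cINF_less_iff) auto
  define K where "K = real k"
  have K: "1 \<le> K" using k by (simp add: K_def)
  define Q where "Q = b\<omega> + R"
  have Q: "0 \<le> Q" using nn R by (simp add: Q_def)
  \<comment> \<open>In \<open>a1\<close> the term R has weight 2 + 1 / k; the surplus over 1 + 1 / k
    is dropped.\<close>
  have "2 * Q * (1 + 1 / K) \<le> 2 * b\<omega> * (1 + 1 / K) + 2 * R * (2 + 1 / K)"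
    using R by (simp add: Q_def algebra_simps)
  then have "2 * Q * (1 + 1 / K) < X" using ka(1) by (simp only: a1 K_def)
  moreover have "0 \<le> 2 * Q * (1 + 1 / K)" using Q K by simp
  ultimately have X: "0 < X" and QX: "2 * Q * (1 + 1 / K) * K < X * K"
    using K by (auto intro!: mult_strict_right_mono)
  have "2 * Q * (1 + 1 / K) * K = 2 * Q * (K + 1)" using K by (simp add: field_simps)
  then have QX': "2 * Q * (K + 1) < X * K" using QX by linarith
  have "\<Omega> = X - Q" by (simp only: \<Omega>_def X_def R_def Q_def)
  then have "2 * (K + 1) * \<Omega> = 2 * (K + 1) * (X - Q)" by (rule arg_cong)
  also have "\<dots> = 2 * (K + 1) * X - 2 * Q * (K + 1)" by (simp add: algebra_simps)
  finally have "2 * (K + 1) * \<Omega> = 2 * (K + 1) * X - 2 * Q * (K + 1)" .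
  moreover have "(K + 2) * X = 2 * (K + 1) * X - X * K" by (simp add: algebra_simps)
  ultimately have \<Omega>: "(K + 2) * X < 2 * (K + 1) * \<Omega>" using QX' by linarith
  moreover have "0 < (K + 2) * X" using K X by simp
  ultimately have "0 < 2 * (K + 1) * \<Omega>" by linarith
  then show \<Omega>0: "0 < \<Omega>" using K by (simp add: zero_less_mult_iff)
  define M where "M = (2 * K + 1) * v + 2 * pi * (K + 1) * Y"
  define V where "V = 9/4 * v + 2 * pi * Y"
  have M: "2 * b\<rho> * M < X * \<Delta>\<gamma>"
    using ka(2) nn(8) unfolding a2 K_def[symmetric] M_def[symmetric] by (simp add: pos_divide_less_eq)
  \<comment> \<open>For the coefficients of v the claim is (4 k + 5) (k - 1) >= 0, an equality at k
    = 1: this is where 9/4 is the largest admissible constant. For those of Y it is 2 <= k +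
    2.\<close>
  have VM: "2 * (K + 1) * V \<le> (K + 2) * M"
  proof -
    have "0 \<le> (4 * K + 5) * (K - 1)" using K by simp
    also have "\<dots> = 2 * ((K + 2) * (2 * K + 1)) - 9 * (K + 1)" by (simp add: algebra_simps)
    finally have "9/2 * (K + 1) \<le> (K + 2) * (2 * K + 1)" by simp
    then have "9/2 * (K + 1) * v \<le> (K + 2) * (2 * K + 1) * v" using nn by (intro mult_right_mono) auto
    moreover have "2 * ((K + 1) * (2 * pi * Y)) \<le> (K + 2) * ((K + 1) * (2 * pi * Y))"
      using K Y by (intro mult_right_mono) auto
    ultimately show ?thesis by (simp add: V_def M_def algebra_simps)
  qed
  have "2 * (K + 1) * (2 * b\<rho> * V) = 2 * b\<rho> * (2 * (K + 1) * V)" by simp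
  also have "\<dots> \<le> 2 * b\<rho> * ((K + 2) * M)" using VM nn by (intro mult_left_mono) auto
  also have "\<dots> = (K + 2) * (2 * b\<rho> * M)" by simp
  also have "\<dots> \<le> (K + 2) * (X * \<Delta>\<gamma>)" using M K by (intro mult_left_mono) auto
  also have "\<dots> = ((K + 2) * X) * \<Delta>\<gamma>" by simp
  also have "\<dots> < (2 * (K + 1) * \<Omega>) * \<Delta>\<gamma>" using \<Omega> nn(8) by (rule mult_strict_right_mono)
  also have "\<dots> = 2 * (K + 1) * (\<Omega> * \<Delta>\<gamma>)" by simp
  finally have "2 * b\<rho> * V < \<Omega> * \<Delta>\<gamma>" using K by simp
  then have "b\<rho> * V / \<Omega> < \<Delta>\<gamma> / 2" using \<Omega>0 by (simp add: pos_divide_less_eq mult.commute mult.left_commute)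
  then show "b\<rho> * (9/4 * v + 2 * pi * (b_lam + \<Gamma> / \<Delta>)) / \<Omega> < \<Delta>\<gamma> / 2"
    by (simp only: V_def Y_def)
qed

section \<open>From the closed loop to the scalar system\<close>

lemma C1_time_deriv:
  assumes "C1_on {0..} g"
  shows "0 < t \<Longrightarrow> (g has_real_derivative time_deriv g t) (at t)" and "continuous_on {0..} g"
proof -
  obtain g' where g': "\<And>x. x \<in> {0..} \<Longrightarrow> (g has_derivative blinfun_apply (g' x)) (at x within {0..})"
    using assms unfolding C1_on_def by blast
  then show "continuous_on {0..} g"
    by (auto intro!: has_derivative_continuous_on)
  assume t: "0 < t"
  have w: "at t within {0..} = at t"
    by (rule at_within_open_subset[of t "{0<..}"]) (use t in auto)
  have "(g has_derivative blinfun_apply (g' t)) (at t)" using g'[of t] t w by simp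
  then have "g differentiable at t" by (auto simp: differentiable_def)
  then have "(g has_real_derivative vector_derivative g (at t)) (at t)"
    by (simp add: vector_derivative_works has_real_derivative_iff_has_vector_derivative)
  then show "(g has_real_derivative time_deriv g t) (at t)" by (simp add: time_deriv_def w)
qed

theorem theorem4p2:
  fixes D :: "real \<Rightarrow> real^2 \<Rightarrow> real"
    and r0 :: "real \<Rightarrow> real^2"
    and \<gamma>inf \<gamma>m \<gamma>s \<gamma>p :: "real \<Rightarrow> real"
    and Rstar v :: real
    and r_in :: "real^2"
    and b\<rho> b_lam b\<omega> b\<omega>grad b\<kappa> bv b\<alpha> b\<tau> bn \<gamma>p0 \<gamma>bar :: real
    and \<Delta>grad \<Delta>\<gamma> dstar \<nu> \<mu> \<epsilon> :: real
    and r :: "real \<Rightarrow> real^2"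
  assumes v_pos: "v > 0" and Rstar_pos: "Rstar > 0"
    \<comment> \<open>(A1)\<close>
    and A1_C2: "C2_on ({0..} \<times> UNIV) (\<lambda>(t, p). D t p)"
    and A1_cont: "continuous_on {0..} r0" "continuous_on {0..} \<gamma>inf"
    and A1_lt: "\<And>t. t \<ge> 0 \<Longrightarrow> \<gamma>inf t < D t (r0 t)"
    and A1_grad: "\<And>t p. t \<ge> 0 \<Longrightarrow> p \<noteq> r0 t \<Longrightarrow> gradient (D t) p \<noteq> 0"
    and A1_lim: "\<And>t. t \<ge> 0 \<Longrightarrow> (D t \<longlongrightarrow> \<gamma>inf t) at_infinity"
    \<comment> \<open>(A2)\<close>
    and A2_smooth: "C1_on {0..} \<gamma>m" "C1_on {0..} \<gamma>s" "C1_on {0..} \<gamma>p"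
    and A2_levels: "\<And>t. t \<ge> 0 \<Longrightarrow>
          \<gamma>inf t < \<gamma>m t \<and> \<gamma>m t < \<gamma>s t \<and> \<gamma>s t < \<gamma>p t \<and> \<gamma>p t < D t (r0 t)"
    and A2_init: "\<gamma>m 0 < D 0 r_in"
    and A2_V: "\<And>t p. t \<ge> 0 \<Longrightarrow> D t p \<ge> \<gamma>s t \<Longrightarrow> p \<in> ball (r0 t) Rstar"
    \<comment> \<open>(A3)\<close>
    and A3_field: "\<And>t p. (t, p) \<in> Z_reg D \<gamma>m \<gamma>p \<Longrightarrow>
          \<bar>rho D t p\<bar> \<le> b\<rho> \<and> \<bar>front_vel D t p\<bar> \<le> b_lam \<and> \<bar>omega D t p\<bar> \<le> b\<omega> \<and>
          \<bar>omega_grad D t p\<bar> \<le> b\<omega>grad \<and> \<bar>kappa D t p\<bar> \<le> b\<kappa> \<and> \<bar>v_rho D t p\<bar> \<le> bv \<and>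
          \<bar>front_acc D t p\<bar> \<le> b\<alpha> \<and> \<bar>tau_rho D t p\<bar> \<le> b\<tau> \<and> \<bar>n_rho D t p\<bar> \<le> bn"
    and A3_levels: "\<And>t. t \<ge> 0 \<Longrightarrow> \<gamma>p t \<le> \<gamma>p0 \<and>
          \<bar>time_deriv \<gamma>m t\<bar> \<le> \<gamma>bar \<and> \<bar>time_deriv \<gamma>p t\<bar> \<le> \<gamma>bar \<and> \<bar>time_deriv \<gamma>s t\<bar> \<le> \<gamma>bar"
    \<comment> \<open>(A4)\<close>
    and A4: "\<exists>e>0.
          (\<forall>(t, p)\<in>Z_reg D \<gamma>m \<gamma>p. rho D t p \<ge> e \<and>
              v \<ge> \<bar>front_vel D t p\<bar> + inverse (rho D t p) * \<gamma>bar + e) \<and>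
          (\<forall>t\<ge>0. \<gamma>m t + e \<le> \<gamma>s t \<and> \<gamma>s t \<le> \<gamma>p t - e)"
    \<comment> \<open>margins\<close>
    and \<Delta>grad_pos: "\<Delta>grad > 0" and \<Delta>\<gamma>_pos: "\<Delta>\<gamma> > 0"
    and \<Delta>grad: "\<And>t p. (t, p) \<in> Z_reg D \<gamma>m \<gamma>p \<Longrightarrow> rho D t p \<ge> \<Delta>grad"
    and \<Delta>\<gamma>: "\<And>t. t \<ge> 0 \<Longrightarrow> \<gamma>m t + \<Delta>\<gamma> \<le> \<gamma>s t \<and> \<gamma>s t \<le> \<gamma>p t - \<Delta>\<gamma>"
    and \<Delta>\<gamma>_init: "D 0 r_in \<ge> \<gamma>m 0 + \<Delta>\<gamma> / 2"
    \<comment> \<open>controller parameters\<close>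
    and \<nu>_pos: "\<nu> > 0" and \<mu>_pos: "\<mu> > 0" and \<epsilon>_pos: "\<epsilon> > 0"
    and a_nu: "\<nu> > \<gamma>bar"
    and a_speed: "\<And>t p. (t, p) \<in> Z_reg D \<gamma>m \<gamma>p \<Longrightarrow>
          v \<ge> \<bar>front_vel D t p\<bar> + inverse (rho D t p) * \<nu> + \<epsilon>"
    and b: "\<And>t p vT. (t, p) \<in> Z_reg D \<gamma>m \<gamma>p \<Longrightarrow>
          vT = sqrt (v^2 - (front_vel D t p + inverse (rho D t p) * \<gamma>bar)^2) \<or>
          vT = - sqrt (v^2 - (front_vel D t p + inverse (rho D t p) * \<gamma>bar)^2) \<Longrightarrow>
          \<mu> \<ge> 1 / (\<nu> - \<gamma>bar) *
                (- 2 * omega D t p - kappa D t p * vT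
                 + 2 * (tau_rho D t p * \<gamma>bar / rho D t p)
                 + 2 * (v_rho D t p * \<gamma>bar / (vT * rho D t p))
                 - front_acc D t p / vT
                 + n_rho D t p * \<gamma>bar^2 / (vT * (rho D t p)^2)) + \<epsilon>"
    and c: "\<And>t p. (t, p) \<in> Z_reg D \<gamma>m \<gamma>p \<Longrightarrow>
          \<mu> \<ge> (omega D t p + tau_rho D t p * (front_vel D t p - v))
                / (rho D t p * (v - front_vel D t p) - \<nu>) + \<epsilon>"
    and d: "\<mu> > 1 / (\<nu> - \<gamma>bar) * min_a v b\<rho> b_lam b\<omega>grad b\<kappa> b\<tau> \<gamma>bar \<Delta>grad \<Delta>\<gamma>"
    and traj: "closed_loop_trajectory D v \<mu> \<nu> dstar r_in r"
  shows "\<exists>t0\<ge>0. \<forall>t\<ge>t0. r t \<in> ball (r0 t) Rstar"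
proof -
  have \<gamma>bar0: "0 \<le> \<gamma>bar" using A3_levels[of 0] by auto
  have cont_D: "continuous_on ({0..} \<times> UNIV) (\<lambda>(t, p). D t p)"
  proof -
    obtain D' where "\<And>x. x \<in> {0..} \<times> UNIV \<Longrightarrow>
        ((\<lambda>(t, p). D t p) has_derivative blinfun_apply (D' x)) (at x within {0..} \<times> UNIV)"
      using A1_C2 unfolding C2_on_def by blast
    then show ?thesis by (rule has_derivative_continuous_on)
  qed
  have cont_slice: "continuous_on UNIV (D 0)"
  proof -
    have "continuous_on UNIV ((\<lambda>(t, p). D t p) \<circ> (\<lambda>p. (0, p)))"
      by (intro continuous_on_compose continuous_intros continuous_on_subset[OF cont_D]) auto
    then show ?thesis by (simp add: o_def)
  qed
  \<comment> \<open>The bounds in (A3) are known to be nonnegative only if the zone is nonempty. At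
    time 0 the field takes values below \<open>\<gamma>m\<close> far away and above it at the
    maximizer, so it attains \<open>\<gamma>m\<close> by connectedness.\<close>
  obtain p0 where p0: "(0, p0) \<in> Z_reg D \<gamma>m \<gamma>p"
  proof -
    have "\<forall>\<^sub>F p in at_infinity. D 0 p < \<gamma>m 0"
      using A1_lim[of 0] A2_levels[of 0] by (intro order_tendstoD(2)) auto
    then obtain q where q: "D 0 q < \<gamma>m 0"
      using eventually_happens[of _ at_infinity] trivial_limit_at_infinity by blast
    have "connected (D 0 ` UNIV)"
      by (rule connected_continuous_image[OF cont_slice connected_UNIV])
    then have "\<gamma>m 0 \<in> D 0 ` UNIV"
      by (rule connectedD_interval[of _ "D 0 q" "D 0 (r0 0)"]) (use q A2_levels[of 0] in auto)
    then show ?thesis using that A2_levels[of 0] by (force simp: Z_reg_def)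
  qed
  have b0: "0 \<le> b\<rho>" "0 \<le> b_lam" "0 \<le> b\<omega>grad"
    using A3_field[OF p0] by (meson abs_ge_zero order_trans)+
  \<comment> \<open>The control contributes at least \<mu> (\<nu> - \<open>\<gamma>bar\<close>) to
    the turning rate while the field rate is at most \<open>\<gamma>bar\<close>; the subtracted
    terms bound the rotation of the gradient seen by the moving robot.\<close>
  define \<Omega> where "\<Omega> = \<mu> * (\<nu> - \<gamma>bar) - (b\<omega>grad + v * sqrt (b\<kappa>\<^sup>2 + b\<tau>\<^sup>2))"
  have \<Omega>0: "0 < \<Omega>" and loss: "b\<rho> * (9/4 * v + 2 * pi * (b_lam + \<gamma>bar / \<Delta>grad)) / \<Omega> < \<Delta>\<gamma> / 2"
    using turning_rate_margin[OF b0(3) v_pos b0(1,2) \<gamma>bar0 a_nu \<Delta>grad_pos \<Delta>\<gamma>_pos d]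
    by (simp_all add: \<Omega>_def)
  obtain \<delta> c where \<delta>: "0 < \<delta>" "0 < c" and strip:
    "\<And>\<rho> l om ka vr al ta n S Cp Sp. \<Delta>grad \<le> \<rho> \<Longrightarrow> \<bar>l\<bar> \<le> b_lam \<Longrightarrow> \<bar>om\<bar> \<le> b\<omega> \<Longrightarrow> \<bar>ka\<bar> \<le> b\<kappa> \<Longrightarrow>
       \<bar>vr\<bar> \<le> bv \<Longrightarrow> \<bar>al\<bar> \<le> b\<alpha> \<Longrightarrow> \<bar>ta\<bar> \<le> b\<tau> \<Longrightarrow> \<bar>n\<bar> \<le> bn \<Longrightarrow> \<bar>l\<bar> + \<nu> / \<rho> + \<epsilon> \<le> v \<Longrightarrow>
       (\<And>vT. vT = sqrt (v\<^sup>2 - (l + \<gamma>bar / \<rho>)\<^sup>2) \<or> vT = - sqrt (v\<^sup>2 - (l + \<gamma>bar / \<rho>)\<^sup>2) \<Longrightarrow>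
         \<mu> \<ge> 1 / (\<nu> - \<gamma>bar) *
          (- 2 * om - ka * vT + 2 * (ta * \<gamma>bar / \<rho>) + 2 * (vr * \<gamma>bar / (vT * \<rho>)) - al / vT
            + n * \<gamma>bar\<^sup>2 / (vT * \<rho>\<^sup>2)) + \<epsilon>) \<Longrightarrow>
       S = \<rho> * (v * Cp - l) \<Longrightarrow> Cp\<^sup>2 + Sp\<^sup>2 = 1 \<Longrightarrow> \<gamma>bar \<le> S \<Longrightarrow> S \<le> \<gamma>bar + \<delta> \<Longrightarrow>
       Sp \<noteq> 0 \<and>
       (Sp < 0 \<longrightarrow> c \<le> \<rho> * (- al + 2 * vr * (S / \<rho>) + n * (S / \<rho>)\<^sup>2
          + v * Sp * (- 2 * om + 2 * ta * (S / \<rho>) - ka * (v * Sp) - \<mu> * (\<nu> - S)))) \<and>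
       (Sp > 0 \<longrightarrow> \<rho> * (- al + 2 * vr * (S / \<rho>) + n * (S / \<rho>)\<^sup>2
          + v * Sp * (- 2 * om + 2 * ta * (S / \<rho>) - ka * (v * Sp) - \<mu> * (\<nu> - S))) \<le> - c)"
    by (fact strip_estimate[OF v_pos \<epsilon>_pos \<gamma>bar0 a_nu \<Delta>grad_pos])
  define \<theta> where "\<theta> t = \<mu> * (D t (r t) - \<nu> * t - dstar)" for t
  have r0: "r 0 = r_in" and rw: "\<And>t. 0 \<le> t \<Longrightarrow> (r has_vector_derivative v *\<^sub>R evec (\<theta> t)) (at t within {0..})"
    using traj by (simp_all add: closed_loop_trajectory_def \<theta>_def)
  have r: "(r has_vector_derivative v *\<^sub>R evec (\<theta> t)) (at t)" if "0 < t" for t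
  proof -
    have "at t within {0..} = at t"
      by (rule at_within_open_subset[of t "{0<..}"]) (use that in auto)
    then show ?thesis using rw[of t] that by simp
  qed
  define g where "g i t = gradient (D t) (r t) $ i" for i t
  define b' where "b' i t = grad_Dt D t (r t) $ i" for i t
  define H where "H i j t = hessian (D t) (r t) $ i $ j" for i j t
  define gd where "gd i t = b' i t + v * (cos (\<theta> t) * H i 1 t + sin (\<theta> t) * H i 2 t)" for i t
  define \<rho> where "\<rho> t = rho D t (r t)" for t
  define C where "C t = (cos (\<theta> t) * g 1 t + sin (\<theta> t) * g 2 t) / \<rho> t" for t
  define S where "S t = (cos (\<theta> t) * g 2 t - sin (\<theta> t) * g 1 t) / \<rho> t" for t
  define d1 where "d1 t = Dt D t (r t) + v * (cos (\<theta> t) * g 1 t + sin (\<theta> t) * g 2 t)" for t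
  define d2 where "d2 t = Dtt D t (r t) + v * (cos (\<theta> t) * b' 1 t + sin (\<theta> t) * b' 2 t)
    + v * (cos (\<theta> t) * gd 1 t + sin (\<theta> t) * gd 2 t
      + (cos (\<theta> t) * g 2 t - sin (\<theta> t) * g 1 t) * (\<mu> * (d1 t - \<nu>)))" for t
  define W where "W t = (g 1 t * gd 2 t - g 2 t * gd 1 t) / (\<rho> t)\<^sup>2 - \<mu> * (d1 t - \<nu>)" for t
  define Z where "Z t \<longleftrightarrow> 0 < t \<and> \<gamma>m t \<le> D t (r t) \<and> D t (r t) \<le> \<gamma>p t" for t
  have Zreg: "(t, r t) \<in> Z_reg D \<gamma>m \<gamma>p" "0 < t" if "Z t" for t
    using that by (auto simp: Z_def Z_reg_def)
  note field = field_along_trajectory[OF A1_C2 r]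
  have d_deriv: "((\<lambda>t. D t (r t)) has_real_derivative d1 t) (at t)" if "0 < t" for t
    using field(1)[OF _ that] by (simp add: d1_def g_def)
  have \<theta>_deriv: "(\<theta> has_real_derivative \<mu> * (d1 t - \<nu>)) (at t)" if "0 < t" for t
    unfolding \<theta>_def using d_deriv[OF that] by (auto intro!: derivative_eq_intros)
  have g_deriv: "(g i has_real_derivative gd i t) (at t)" if "0 < t" for i t
    using field(3)[OF _ that, of i] by (simp add: g_def[abs_def] gd_def b'_def H_def)
  have d1_deriv: "(d1 has_real_derivative d2 t) (at t)" if t: "0 < t" for t
    unfolding d1_def[abs_def] d2_def
    using field(2)[OF _ t] \<theta>_deriv[OF t] g_deriv[OF t, of 1] g_deriv[OF t, of 2]
    by (auto intro!: derivative_eq_intros simp: b'_def d1_def algebra_simps)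
  have g_sq: "(\<lambda>t. sqrt ((g 1 t)\<^sup>2 + (g 2 t)\<^sup>2)) = \<rho>"
    by (auto simp: \<rho>_def rho_def norm_real2 g_def)
  have \<rho>: "\<Delta>grad \<le> \<rho> t" "0 < \<rho> t" if "Z t" for t
    using \<Delta>grad[OF Zreg(1)[OF that]] \<Delta>grad_pos by (auto simp: \<rho>_def)
  have g_pos: "0 < (g 1 t)\<^sup>2 + (g 2 t)\<^sup>2" if "Z t" for t
    using \<rho>(2)[OF that] by (simp flip: g_sq)
  have frame: "(C has_real_derivative - (W t * S t)) (at t)" "(S has_real_derivative W t * C t) (at t)" if "Z t" for t
    using frame_deriv[OF g_deriv g_deriv \<theta>_deriv g_pos[OF that]] Zreg(2)[OF that]
    unfolding fun_cong[OF g_sq] by (simp_all add: C_def[abs_def] S_def[abs_def] W_def)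
  have H_sym: "hessian (D t) (r t) $ 2 $ 1 = hessian (D t) (r t) $ 1 $ 2" if "0 < t" for t
    using field(4)[OF _ that] .
  have trig: "(cos (\<theta> t))\<^sup>2 + (sin (\<theta> t))\<^sup>2 = 1" for t by simp
  have ids: "(C t)\<^sup>2 + (S t)\<^sup>2 = 1"
    "d1 t = \<rho> t * (v * C t - front_vel D t (r t))"
    "omega_grad D t (r t) = omega D t (r t) + front_vel D t (r t) * tau_rho D t (r t)"
    "W t = omega_grad D t (r t) + kappa D t (r t) * (v * S t) - tau_rho D t (r t) * (v * C t) - \<mu> * (d1 t - \<nu>)"
    "d2 t = \<rho> t * (- front_acc D t (r t) + 2 * v_rho D t (r t) * (d1 t / \<rho> t) + n_rho D t (r t) * (d1 t / \<rho> t)\<^sup>2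
          + v * S t * (- 2 * omega D t (r t) + 2 * tau_rho D t (r t) * (d1 t / \<rho> t)
            - kappa D t (r t) * (v * S t) - \<mu> * (\<nu> - d1 t)))" if "Z t" for t
  proof -
    have \<rho>': "0 < rho D t (r t)" using \<rho>(2)[OF that] by (simp add: \<rho>_def)
    note fi = frame_identities[OF H_sym[OF Zreg(2)[OF that]] trig[of t] \<rho>']
    show "(C t)\<^sup>2 + (S t)\<^sup>2 = 1" using fi(1) by (simp add: C_def S_def g_def \<rho>_def)
    show d1: "d1 t = \<rho> t * (v * C t - front_vel D t (r t))"
      using fi(2)[of v] by (simp add: C_def d1_def g_def \<rho>_def)
    show "omega_grad D t (r t) = omega D t (r t) + front_vel D t (r t) * tau_rho D t (r t)" using fi(3) .
    show "W t = omega_grad D t (r t) + kappa D t (r t) * (v * S t) - tau_rho D t (r t) * (v * C t) - \<mu> * (d1 t - \<nu>)"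
      using fi(4)[where v = v] by (simp add: W_def C_def S_def g_def gd_def b'_def H_def \<rho>_def H_sym[OF Zreg(2)[OF that]])
    show "d2 t = \<rho> t * (- front_acc D t (r t) + 2 * v_rho D t (r t) * (d1 t / \<rho> t) + n_rho D t (r t) * (d1 t / \<rho> t)\<^sup>2
          + v * S t * (- 2 * omega D t (r t) + 2 * tau_rho D t (r t) * (d1 t / \<rho> t)
            - kappa D t (r t) * (v * S t) - \<mu> * (\<nu> - d1 t)))"
      unfolding d2_def d1
      using fi(5)[where v = v and \<mu> = \<mu> and \<nu> = \<nu>]
      unfolding C_def S_def g_def gd_def b'_def H_def \<rho>_def H_sym[OF Zreg(2)[OF that]] .
  qed
  have speed: "\<bar>front_vel D t (r t)\<bar> + \<nu> / \<rho> t + \<epsilon> \<le> v" if "Z t" for t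
    using a_speed[OF Zreg(1)[OF that]] by (simp add: \<rho>_def divide_inverse mult.commute)
  have bounds: "\<bar>rho D t (r t)\<bar> \<le> b\<rho>" "\<bar>front_vel D t (r t)\<bar> \<le> b_lam" "\<bar>omega D t (r t)\<bar> \<le> b\<omega>"
    "\<bar>omega_grad D t (r t)\<bar> \<le> b\<omega>grad" "\<bar>kappa D t (r t)\<bar> \<le> b\<kappa>" "\<bar>v_rho D t (r t)\<bar> \<le> bv"
    "\<bar>front_acc D t (r t)\<bar> \<le> b\<alpha>" "\<bar>tau_rho D t (r t)\<bar> \<le> b\<tau>" "\<bar>n_rho D t (r t)\<bar> \<le> bn" if "Z t" for t
    using A3_field[OF Zreg(1)[OF that]] by auto
  have b': "\<mu> \<ge> 1 / (\<nu> - \<gamma>bar) *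
      (- 2 * omega D t (r t) - kappa D t (r t) * vT + 2 * (tau_rho D t (r t) * \<gamma>bar / \<rho> t)
        + 2 * (v_rho D t (r t) * \<gamma>bar / (vT * \<rho> t)) - front_acc D t (r t) / vT
        + n_rho D t (r t) * \<gamma>bar\<^sup>2 / (vT * (\<rho> t)\<^sup>2)) + \<epsilon>"
    if "Z t" "vT = sqrt (v\<^sup>2 - (front_vel D t (r t) + \<gamma>bar / \<rho> t)\<^sup>2)
      \<or> vT = - sqrt (v\<^sup>2 - (front_vel D t (r t) + \<gamma>bar / \<rho> t)\<^sup>2)" for t vT
  proof -
    have "inverse (rho D t (r t)) * \<gamma>bar = \<gamma>bar / \<rho> t"
      by (simp add: \<rho>_def divide_inverse mult.commute)
    then show ?thesis
      using b[OF Zreg(1)[OF that(1)], of vT] that(2) unfolding \<rho>_def by (simp only:)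
  qed
  have in_strip: "S t \<noteq> 0 \<and> (S t < 0 \<longrightarrow> c \<le> d2 t) \<and> (S t > 0 \<longrightarrow> d2 t \<le> - c)"
    if t: "Z t" and d: "\<gamma>bar \<le> d1 t" "d1 t \<le> \<gamma>bar + \<delta>" for t
    unfolding ids(5)[OF t]
    by (rule strip[OF \<rho>(1)[OF t] bounds(2,3,5,6,7,8,9)[OF t] speed[OF t] b'[OF t] ids(2,1)[OF t] d])
  have rot: "\<Omega> \<le> W t" if t: "Z t" and low: "d1 t \<le> \<gamma>bar" for t
  proof -
    define k where "k = kappa D t (r t)"
    define u where "u = tau_rho D t (r t)"
    \<comment> \<open>Lagrange's identity, giving the Cauchy-Schwarz bound for (\<kappa>, \<tau>)
      against the unit vector; this is the origin of the square root in \<open>a1\<close>.\<close>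
    have "(k * S t - u * C t)\<^sup>2 + (k * C t + u * S t)\<^sup>2 = (k\<^sup>2 + u\<^sup>2) * ((C t)\<^sup>2 + (S t)\<^sup>2)"
      by (simp add: power2_eq_square algebra_simps)
    then have "(k * S t - u * C t)\<^sup>2 + (k * C t + u * S t)\<^sup>2 = k\<^sup>2 + u\<^sup>2"
      unfolding ids(1)[OF t] by simp
    then have "(k * S t - u * C t)\<^sup>2 \<le> k\<^sup>2 + u\<^sup>2"
      using zero_le_power2[of "k * C t + u * S t"] by linarith
    also have "\<dots> \<le> b\<kappa>\<^sup>2 + b\<tau>\<^sup>2"
      using bounds(5,8)[OF t] unfolding k_def u_def
      by (intro add_mono) (metis abs_ge_zero power2_abs power_mono)+
    finally have "\<bar>k * S t - u * C t\<bar> \<le> sqrt (b\<kappa>\<^sup>2 + b\<tau>\<^sup>2)"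
      by (metis real_sqrt_abs real_sqrt_le_mono)
    then have "v * (k * S t - u * C t) \<ge> v * - sqrt (b\<kappa>\<^sup>2 + b\<tau>\<^sup>2)"
      using v_pos by (intro mult_left_mono) auto
    moreover have "\<mu> * (d1 t - \<nu>) \<le> \<mu> * (\<gamma>bar - \<nu>)" using low \<mu>_pos by simp
    ultimately show ?thesis
      using bounds(4)[OF t] unfolding ids(4)[OF t] \<Omega>_def k_def u_def by (simp add: algebra_simps)
  qed
  \<comment> \<open>For a velocity along N the rate is \<omega> + \<tau> (\<lambda> - v) - \<mu>
    (\<rho> (v - \<lambda>) - \<nu>). Condition (a) makes the denominator in (c) positive, so (c)
    can be multiplied out.\<close>
  have turn: "W t < 0" if t: "Z t" and "S t = 0" "C t = 1" for t
  proof -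
    let ?l = "front_vel D t (r t)" and ?u = "tau_rho D t (r t)"
    have d1: "d1 t = \<rho> t * (v - ?l)" using ids(2)[OF t] that by simp
    have "\<nu> / \<rho> t < v - ?l" using speed[OF t] \<epsilon>_pos by linarith
    then have den: "0 < \<rho> t * (v - ?l) - \<nu>" using \<rho>(2)[OF t] by (simp add: pos_divide_less_eq mult.commute)
    have "(omega D t (r t) + ?u * (?l - v)) / (\<rho> t * (v - ?l) - \<nu>) < \<mu>"
      using c[OF Zreg(1)[OF t]] \<epsilon>_pos by (simp add: \<rho>_def)
    then have "omega D t (r t) + ?u * (?l - v) < \<mu> * (\<rho> t * (v - ?l) - \<nu>)"
      using den by (simp add: pos_divide_less_eq)
    then show ?thesis unfolding ids(4)[OF t] ids(3)[OF t] d1 using that by (simp add: algebra_simps)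
  qed
  have W_cont: "isCont W t" if t: "Z t" for t
  proof -
    have t0: "0 < t" using Zreg(2)[OF t] .
    have c: "isCont (g i) t" "isCont \<theta> t" "isCont d1 t" for i
      using DERIV_isCont[OF g_deriv[OF t0]] DERIV_isCont[OF \<theta>_deriv[OF t0]] DERIV_isCont[OF d1_deriv[OF t0]] by auto
    have cb: "isCont (b' i) t" "isCont (H i j) t" for i j
      using field(5,6)[OF _ t0] by (simp_all add: b'_def[abs_def] H_def[abs_def])
    have "isCont (gd i) t" for i
      unfolding gd_def[abs_def] by (intro continuous_intros c cb)
    moreover have "isCont \<rho> t" unfolding g_sq[symmetric] by (intro continuous_intros c)
    ultimately show ?thesis
      unfolding W_def[abs_def] using \<rho>(2)[OF t] by (intro continuous_intros c) auto
  qed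
  have slow: "slow \<gamma>bar \<gamma>m" "slow \<gamma>bar \<gamma>s" "slow \<gamma>bar \<gamma>p"
    unfolding slow_def
    by (rule exI[of _ "time_deriv \<gamma>m"] exI[of _ "time_deriv \<gamma>s"] exI[of _ "time_deriv \<gamma>p"],
        use C1_time_deriv(1)[OF A2_smooth(1)] C1_time_deriv(1)[OF A2_smooth(2)] C1_time_deriv(1)[OF A2_smooth(3)]
          A3_levels in \<open>force simp: abs_le_iff\<close>)+
  define L where "L = b\<rho> * (9/4 * v + 2 * pi * (b_lam + \<gamma>bar / \<Delta>grad)) / \<Omega>"
  \<comment> \<open>At time 0 the margin is at least \<Delta>\<gamma> / 2 > L and positive;
    \<open>max L 0\<close> carries both strict inequalities to small positive times by
    continuity.\<close>
  have init: "\<exists>\<eta>>0. L < D \<eta> (r \<eta>) - \<gamma>m \<eta> \<and> \<gamma>m \<eta> < D \<eta> (r \<eta>)"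
  proof -
    have "continuous_on {0..} r"
      using rw by (auto simp: continuous_on_eq_continuous_within intro: has_vector_derivative_continuous)
    then have "continuous_on {0..} ((\<lambda>(t, p). D t p) \<circ> (\<lambda>t. (t, r t)))"
      by (intro continuous_on_compose continuous_intros continuous_on_subset[OF cont_D]) auto
    then have "continuous_on {0..} (\<lambda>t. D t (r t) - \<gamma>m t)"
      by (intro continuous_intros C1_time_deriv(2)[OF A2_smooth(1)]) (simp add: o_def)
    then have "((\<lambda>t. D t (r t) - \<gamma>m t) \<longlongrightarrow> D 0 (r 0) - \<gamma>m 0) (at_right 0)"
      by (auto simp: continuous_on_def intro: tendsto_within_subset)
    moreover have "max L 0 < D 0 (r 0) - \<gamma>m 0"
      using loss[folded L_def] \<Delta>\<gamma>_init \<Delta>\<gamma>_pos r0 by simp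
    ultimately have "\<forall>\<^sub>F t in at_right 0. max L 0 < D t (r t) - \<gamma>m t"
      by (rule order_tendstoD(1))
    moreover have "\<forall>\<^sub>F t in at_right (0::real). 0 < t" by (simp add: eventually_at_right_less)
    ultimately have "\<forall>\<^sub>F t in at_right 0. max L 0 < D t (r t) - \<gamma>m t \<and> 0 < t"
      by (rule eventually_conj)
    from eventually_happens'[OF trivial_limit_at_right_real this]
    obtain \<eta> where "max L 0 < D \<eta> (r \<eta>) - \<gamma>m \<eta>" "0 < \<eta>"
      by blast
    then show ?thesis by auto
  qed
  interpret spiral "\<lambda>t. D t (r t)" d1 d2 C S W \<rho> "\<lambda>t. front_vel D t (r t)" \<gamma>m \<gamma>s \<gamma>p v \<gamma>bar b\<rho> b_lam \<Delta>grad \<Omega> \<Delta>\<gamma> \<delta> c L Z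
  proof
    show "\<bar>front_vel D t (r t)\<bar> + \<gamma>bar / \<rho> t < v" if "Z t" for t
    proof -
      have "\<gamma>bar / \<rho> t \<le> \<nu> / \<rho> t" using \<rho>(2)[OF that] a_nu by (intro divide_right_mono) auto
      then show ?thesis using speed[OF that] \<epsilon>_pos by linarith
    qed
    show "\<Delta>grad \<le> \<rho> t \<and> \<rho> t \<le> b\<rho>" if "Z t" for t
      using \<rho>[OF that] bounds(1)[OF that] by (simp add: \<rho>_def)
    show "\<gamma>m t + \<Delta>\<gamma> \<le> \<gamma>s t \<and> \<gamma>s t + \<Delta>\<gamma> \<le> \<gamma>p t" if "0 < t" for t
      using \<Delta>\<gamma>[of t] that by auto
    show "c \<le> d2 t" if "Z t" "\<gamma>bar \<le> d1 t" "d1 t \<le> \<gamma>bar + \<delta>" "S t < 0" for t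
      using in_strip that by blast
    show "d2 t \<le> - c" if "Z t" "\<gamma>bar \<le> d1 t" "d1 t \<le> \<gamma>bar + \<delta>" "0 < S t" for t
      using in_strip that by blast
    show "S t \<noteq> 0" if "Z t" "\<gamma>bar \<le> d1 t" "d1 t \<le> \<gamma>bar + \<delta>" for t
      using in_strip that by blast
  qed (fact L_def Z_def d_deriv d1_deriv slow ids(1,2) frame W_cont bounds(2) rot turn \<gamma>bar0 \<delta> \<Omega>0
      \<Delta>grad_pos v_pos loss[folded L_def] \<Delta>\<gamma>_pos init)+
  obtain t0 where t0: "0 < t0" "\<And>t. t0 \<le> t \<Longrightarrow> \<gamma>s t \<le> D t (r t)"
    using eventually_above by blast
  have "r t \<in> ball (r0 t) Rstar" if "t0 \<le> t" for t
    by (rule A2_V) (use t0 that in auto)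
  then show ?thesis using t0(1) by (intro exI[of _ t0]) auto
qed

end
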